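(* Assume that $\int_{\mathbb{H}}\|f\|_{\mathbb{H}}^4\,Q(\mathrm{d}f)<\infty$, and let $X_1,X_2,\ldots$ be independent and identically distributed copies of a random element $X$ of $\mathbb{H}=L^2([0,1],\mathbb{R})$ satisfying $\mathbb{E}\|X\|_{\mathbb{H}}^4<\infty$ and $\mu=\mathbb{E}(X)=0$, with covariance operator $\mathcal{C}$. Then, as $n\to\infty$, $$\sqrt{n}\,(T_n-\tau_Q)\overset{\mathcal{D}}{\to}\mathrm{N}(0,\sigma^2),$$ where $$\sigma^2=4\int_{\mathbb{H}}\int_{\mathbb{H}}K^\star(f,g)\,z(f)\,z(g)\,Q(\mathrm{d}f)\,Q(\mathrm{d}g).$$ Here $\tau_Q=\int_{\mathbb{H}}\left|\varphi_X(f)-\varphi(f;\mu,\mathcal{C})\right|^2Q(\mathrm{d}f)$ with $\varphi_X(f)=\mathbb{E}[\exp(\mathrm{i}\langle X,f\rangle)]$, and, with $\sigma_f^2=\langle\mathcal{C}f,f\rangle$, $$z(f)=\mathbb{E}[\cos\langle f,X\rangle]+\mathbb{E}[\sin\langle f,X\rangle]-\exp\left(-\tfrac12\sigma_f^2\right),\qquad K^\star(f,g)=\mathbb{E}[\xi(f,X)\xi(g,X)],\quad f,g\in\mathbb{H},$$ where, for $x,f\in\mathbb{H}$, $$\xi(f,x)=\cos\langle f,x\rangle-\mathbb{E}\cos\langle f,X\rangle+\sin\langle f,x\rangle-\mathbb{E}\sin\langle f,X\rangle+\langle f,x\rangle\,\mathbb{E}[\sin\langle f,X\rangle-\cos\langle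 f,X\rangle]+\tfrac12e^{-\sigma_f^2/2}\left(\langle f,x\rangle^2-\sigma_f^2\right).$$
   Context: $\mathbb{H}=L^2([0,1],\mathbb{R})$ is the separable Hilbert space of (equivalence classes of) square-integrable real functions on $[0,1]$, with inner product $\langle f,g\rangle=\int_0^1 f(t)g(t)\,\mathrm{d}t$, norm $\|f\|_{\mathbb{H}}=\langle f,f\rangle^{1/2}$, and Borel $\sigma$-algebra. $Q$ is a fixed Borel probability measure on $\mathbb{H}$ that is symmetric, i.e. invariant under the map $x\mapsto -x$. For a random element $X$ of $\mathbb{H}$ with $\mathbb{E}\|X\|_{\mathbb{H}}^2<\infty$ and expectation $\mu\in\mathbb{H}$, the covariance operator $\mathcal{C}:\mathbb{H}\to\mathbb{H}$ is $\mathcal{C}f=\mathbb{E}(\langle X-\mu,f\rangle X)$. For $m\in\mathbb{H}$ and a positive symmetric trace-class operator $\mathcal{K}$ on $\mathbb{H}$, put $\varphi(f;m,\mathcal{K})=\exp\left(\mathrm{i}\langle m,f\rangle-\frac12\langle\mathcal{K}f,f\rangle\right)$, $f\in\mathbb{H}$. Given $X_1,\ldots,X_n$, let $\overline{X}_n=\frac1n\sum_{j=1}^n X_j$, let $\mathcal{C}_n$ be the sample covariance operator $\mathcal{C}_nf(s)=\int_0^1 c_n(s,t)f(t)\,\mathrm{d}t$ with $c_n(s,t)=\frac1n\sum_{j=1}^n\{X_j(s)-\overline{X}_n(s)\}\{X_j(t)-\overline{X}_n(t)\}$, let $\varphi_n(f)=\frac1n\sum_{j=1}^n\exp(\mathrm{i}\langle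 f,X_j\rangle)$, and define $$T_n=\int_{\mathbb{H}}\left|\varphi_n(f)-\varphi(f;\overline{X}_n,\mathcal{C}_n)\right|^2\,Q(\mathrm{d}f).$$ $\overset{\mathcal{D}}{\to}$ denotes convergence in distribution; $\mathrm{N}(0,\sigma^2)$ is the univariate normal distribution, understood as the point mass at $0$ if $\sigma^2=0$. *)

theory Defs
  imports "HOL-Probability.Probability"
begin

section \<open>The Hilbert space of square-integrable functions on the unit interval\<close>

abbreviation unit_lebesgue :: "real measure"
  where "unit_lebesgue \<equiv> lebesgue_on {0..1}"

lemma finite_unit_lebesgue: "finite_measure unit_lebesgue"
  by (rule finite_measureI) (simp add: emeasure_restrict_space)

definition square_integrable :: "(real \<Rightarrow> real) \<Rightarrow> bool"
  where "square_integrable f \<longleftrightarrow>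
    f \<in> borel_measurable unit_lebesgue \<and> integrable unit_lebesgue (\<lambda>t. (f t)\<^sup>2)"

lemma square_integrable_measurable:
  "square_integrable f \<Longrightarrow> f \<in> borel_measurable unit_lebesgue"
  by (simp add: square_integrable_def)

lemma square_integrable_mult:
  assumes "square_integrable f" "square_integrable g"
  shows "integrable unit_lebesgue (\<lambda>t. f t * g t)"
proof (rule Bochner_Integration.integrable_bound)
  have [measurable]: "f \<in> borel_measurable unit_lebesgue" "g \<in> borel_measurable unit_lebesgue"
    using assms by (auto simp: square_integrable_def)
  show "integrable unit_lebesgue (\<lambda>t. (f t)\<^sup>2 + (g t)\<^sup>2)"
    using assms by (auto simp: square_integrable_def)
  show "(\<lambda>t. f t * g t) \<in> borel_measurable unit_lebesgue" by measurable
  have "\<bar>a * b\<bar> \<le> a\<^sup>2 + b\<^sup>2" for a b :: real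
  proof -
    have "2 * (\<bar>a\<bar> * \<bar>b\<bar>) \<le> a\<^sup>2 + b\<^sup>2"
      using sum_squares_bound[of "\<bar>a\<bar>" "\<bar>b\<bar>"] by (simp add: algebra_simps)
    moreover have "0 \<le> \<bar>a\<bar> * \<bar>b\<bar>" by simp
    ultimately show ?thesis unfolding abs_mult by linarith
  qed
  then show "AE t in unit_lebesgue. norm (f t * g t) \<le> norm ((f t)\<^sup>2 + (g t)\<^sup>2)"
    by (intro AE_I2) (metis abs_ge_self order_trans real_norm_def)
qed

lemma square_integrable_zero: "square_integrable (\<lambda>_. 0)"
  by (simp add: square_integrable_def)

lemma square_integrable_add:
  assumes "square_integrable f" "square_integrable g"
  shows "square_integrable (\<lambda>t. f t + g t)"
proof -
  have "integrable unit_lebesgue (\<lambda>t. (f t)\<^sup>2 + (g t)\<^sup>2 + 2 * (f t * g t))"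
    using assms square_integrable_mult[OF assms]
    unfolding square_integrable_def by (intro Bochner_Integration.integrable_add integrable_mult_right) auto
  moreover have "(\<lambda>t. (f t)\<^sup>2 + (g t)\<^sup>2 + 2 * (f t * g t)) = (\<lambda>t. (f t + g t)\<^sup>2)"
    by (auto simp: power2_sum)
  ultimately show ?thesis
    using assms by (auto simp: square_integrable_def)
qed

lemma square_integrable_scale:
  "square_integrable f \<Longrightarrow> square_integrable (\<lambda>t. c * f t)"
  by (auto simp: square_integrable_def power_mult_distrib)

lemma square_integrable_diff:
  assumes "square_integrable f" "square_integrable g"
  shows "square_integrable (\<lambda>t. f t - g t)"
  using square_integrable_add[OF assms(1) square_integrable_scale[OF assms(2), of "-1"]] by simp

definition L2_rel :: "(real \<Rightarrow> real) \<Rightarrow> (real \<Rightarrow> real) \<Rightarrow> bool"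
  where "L2_rel f g \<longleftrightarrow> square_integrable f \<and> square_integrable g \<and>
    (AE t in unit_lebesgue. f t = g t)"

text \<open>
  The space of square-integrable real functions on the unit interval modulo almost-everywhere
  equality. Elements are functions on all of \<^typ>\<open>real\<close>, of which only the restriction to
  the unit interval matters.
\<close>

quotient_type L2 = "real \<Rightarrow> real" / partial: L2_rel
proof (rule part_equivpI)
  show "\<exists>f. L2_rel f f"
    by (rule exI[of _ "\<lambda>_. 0"]) (simp add: L2_rel_def square_integrable_zero)
  show "symp L2_rel"
    by (rule sympI) (auto simp: L2_rel_def eq_commute)
  show "transp L2_rel"
    by (rule transpI) (auto simp: L2_rel_def)
qed

instantiation L2 :: real_inner
begin

lift_definition zero_L2 :: L2 is "\<lambda>_. 0"
  by (simp add: L2_rel_def square_integrable_zero)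

lift_definition plus_L2 :: "L2 \<Rightarrow> L2 \<Rightarrow> L2" is "\<lambda>f g t. f t + g t"
  by (auto simp: L2_rel_def square_integrable_add elim: AE_mp)

lift_definition minus_L2 :: "L2 \<Rightarrow> L2 \<Rightarrow> L2" is "\<lambda>f g t. f t - g t"
  by (auto simp: L2_rel_def square_integrable_diff elim: AE_mp)

lift_definition scaleR_L2 :: "real \<Rightarrow> L2 \<Rightarrow> L2" is "\<lambda>c f t. c * f t"
  by (auto simp: L2_rel_def square_integrable_scale elim: AE_mp)

lift_definition uminus_L2 :: "L2 \<Rightarrow> L2" is "\<lambda>f t. - f t"
  using square_integrable_scale[of _ "-1"] by (auto simp: L2_rel_def elim: AE_mp)

lift_definition inner_L2 :: "L2 \<Rightarrow> L2 \<Rightarrow> real" is "\<lambda>f g. LINT t|unit_lebesgue. f t * g t"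
proof -
  fix f f' g g'
  assume *: "L2_rel f f'" "L2_rel g g'"
  then have [measurable]: "f \<in> borel_measurable unit_lebesgue" "f' \<in> borel_measurable unit_lebesgue"
     "g \<in> borel_measurable unit_lebesgue" "g' \<in> borel_measurable unit_lebesgue"
    by (auto simp: L2_rel_def square_integrable_def)
  show "(LINT t|unit_lebesgue. f t * g t) = (LINT t|unit_lebesgue. f' t * g' t)"
    using * by (intro integral_cong_AE) (auto simp: L2_rel_def)
qed

definition norm_L2 :: "L2 \<Rightarrow> real" where "norm_L2 x = sqrt (inner x x)"
definition sgn_L2 :: "L2 \<Rightarrow> L2" where "sgn_L2 x = inverse (norm x) *\<^sub>R x"
definition dist_L2 :: "L2 \<Rightarrow> L2 \<Rightarrow> real" where "dist_L2 x y = norm (x - y)"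
definition [code del]:
  "(uniformity :: (L2 \<times> L2) filter) = (INF e\<in>{0 <..}. principal {(x, y). dist x y < e})"
definition [code del]:
  "open (U :: L2 set) \<longleftrightarrow> (\<forall>x\<in>U. eventually (\<lambda>(x', y). x' = x \<longrightarrow> y \<in> U) uniformity)"

instance
proof
  fix x y z :: L2 and a b c :: real
  show "x + y + z = x + (y + z)"
    by transfer (auto simp: L2_rel_def algebra_simps intro!: square_integrable_add)
  show "x + y = y + x"
    by transfer (auto simp: L2_rel_def algebra_simps intro!: square_integrable_add)
  show "0 + x = x"
    by transfer (auto simp: L2_rel_def)
  show "- x + x = 0"
    by transfer (auto simp: L2_rel_def square_integrable_zero)
  show "x - y = x + - y"
    by transfer (auto simp: L2_rel_def intro!: square_integrable_diff)
  show "a *\<^sub>R (x + y) = a *\<^sub>R x + a *\<^sub>R y"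
    by transfer (auto simp: L2_rel_def algebra_simps intro!: square_integrable_add square_integrable_scale)
  show "(a + b) *\<^sub>R x = a *\<^sub>R x + b *\<^sub>R x"
    by transfer (auto simp: L2_rel_def algebra_simps intro!: square_integrable_add square_integrable_scale)
  show "a *\<^sub>R b *\<^sub>R x = (a * b) *\<^sub>R x"
    by transfer (auto simp: L2_rel_def algebra_simps intro!: square_integrable_scale)
  show "1 *\<^sub>R x = x"
    by transfer (auto simp: L2_rel_def)
  show "sgn x = inverse (norm x) *\<^sub>R x" by (rule sgn_L2_def)
  show "dist x y = norm (x - y)" by (rule dist_L2_def)
  show "(uniformity :: (L2 \<times> L2) filter) = (INF e\<in>{0 <..}. principal {(x, y). dist x y < e})"
    by (rule uniformity_L2_def)
  show "open U \<longleftrightarrow> (\<forall>x\<in>U. eventually (\<lambda>(x', y). x' = x \<longrightarrow> y \<in> U) uniformity)" for U :: "L2 set"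
    by (rule open_L2_def)
  show "inner x y = inner y x"
    by transfer (simp add: mult.commute)
  show "inner (x + y) z = inner x z + inner y z"
    by transfer (auto simp: L2_rel_def algebra_simps square_integrable_mult)
  show "inner (a *\<^sub>R x) y = a * inner x y"
    by transfer (auto simp: L2_rel_def algebra_simps)
  show "0 \<le> inner x x"
    by transfer simp
  show "inner x x = 0 \<longleftrightarrow> x = 0"
  proof transfer
    fix f assume "L2_rel f f"
    then have sq: "square_integrable f" by (simp add: L2_rel_def)
    have "(LINT t|unit_lebesgue. f t * f t) = 0 \<longleftrightarrow> (AE t in unit_lebesgue. f t * f t = 0)"
      using square_integrable_mult[OF sq sq] by (intro integral_nonneg_eq_0_iff_AE) auto
    then show "(LINT t|unit_lebesgue. f t * f t) = 0 \<longleftrightarrow> L2_rel f (\<lambda>_. 0)"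
      using sq by (simp add: L2_rel_def square_integrable_zero)
  qed
  show "norm x = sqrt (inner x x)" by (rule norm_L2_def)
qed

end

lemma L2_rel_rep: "L2_rel (rep_L2 x) (rep_L2 x)"
  using Quotient_rep_reflp[OF Quotient_L2] .

lemma square_integrable_rep: "square_integrable (rep_L2 x)"
  using L2_rel_rep by (auto simp: L2_rel_def)

lemma abs_rep_L2: "abs_L2 (rep_L2 x) = x"
  using Quotient_abs_rep[OF Quotient_L2] .

lemma L2_rel_refl: "square_integrable f \<Longrightarrow> L2_rel f f"
  by (simp add: L2_rel_def)

lemma abs_L2_eq_iff:
  assumes "square_integrable f" "square_integrable g"
  shows "abs_L2 f = abs_L2 g \<longleftrightarrow> (AE t in unit_lebesgue. f t = g t)"
  using Quotient_rel[OF Quotient_L2, of f g] assms by (auto simp: L2_rel_def)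

lemma rep_abs_L2:
  assumes "square_integrable f"
  shows "AE t in unit_lebesgue. rep_L2 (abs_L2 f) t = f t"
  using abs_L2_eq_iff[OF square_integrable_rep assms, of "abs_L2 f"] by (simp add: abs_rep_L2)

lemma inner_abs_L2:
  "square_integrable f \<Longrightarrow> square_integrable g \<Longrightarrow>
    inner (abs_L2 f) (abs_L2 g) = (LINT t|unit_lebesgue. f t * g t)"
  by (simp add: inner_L2.abs_eq L2_rel_refl)

lemma inner_L2_rep: "inner x y = (LINT t|unit_lebesgue. rep_L2 x t * rep_L2 y t)"
  using inner_abs_L2[OF square_integrable_rep square_integrable_rep, of x y] by (simp add: abs_rep_L2)

lemma norm_abs_L2:
  assumes "square_integrable f"
  shows "(norm (abs_L2 f))\<^sup>2 = (LINT t|unit_lebesgue. (f t)\<^sup>2)"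
  using inner_abs_L2[OF assms assms] by (simp only: power2_norm_eq_inner) (simp add: power2_eq_square)

lemma abs_L2_diff:
  "square_integrable f \<Longrightarrow> square_integrable g \<Longrightarrow>
    abs_L2 f - abs_L2 g = abs_L2 (\<lambda>t. f t - g t)"
  by (simp add: minus_L2.abs_eq L2_rel_refl)

lemma abs_L2_add:
  "square_integrable f \<Longrightarrow> square_integrable g \<Longrightarrow>
    abs_L2 f + abs_L2 g = abs_L2 (\<lambda>t. f t + g t)"
  by (simp add: plus_L2.abs_eq L2_rel_refl)

lemma abs_L2_scale:
  "square_integrable f \<Longrightarrow> c *\<^sub>R abs_L2 f = abs_L2 (\<lambda>t. c * f t)"
  by (simp add: scaleR_L2.abs_eq L2_rel_refl)

lemma square_integrable_bounded:
  assumes [measurable]: "f \<in> borel_measurable unit_lebesgue" and "\<And>t. \<bar>f t\<bar> \<le> B"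
  shows "square_integrable f"
  unfolding square_integrable_def
proof
  show "integrable unit_lebesgue (\<lambda>t. (f t)\<^sup>2)"
  proof (rule finite_measure.integrable_const_bound[OF finite_unit_lebesgue, where B = "B\<^sup>2"])
    show "AE t in unit_lebesgue. norm ((f t)\<^sup>2) \<le> B\<^sup>2"
      using assms(2) by (intro AE_I2) (metis abs_le_square_iff abs_of_nonneg abs_ge_zero order_trans
        real_norm_def power_abs power2_abs zero_le_power2)
  qed measurable
qed (fact assms)

lemma square_integrable_dominated:
  assumes [measurable]: "f \<in> borel_measurable unit_lebesgue"
    and g: "square_integrable g" and "AE t in unit_lebesgue. \<bar>f t\<bar> \<le> \<bar>g t\<bar>"
  shows "square_integrable f"
  unfolding square_integrable_def
proof
  show "integrable unit_lebesgue (\<lambda>t. (f t)\<^sup>2)"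
  proof (rule Bochner_Integration.integrable_bound)
    show "integrable unit_lebesgue (\<lambda>t. (g t)\<^sup>2)" using g by (simp add: square_integrable_def)
    show "AE t in unit_lebesgue. norm ((f t)\<^sup>2) \<le> norm ((g t)\<^sup>2)"
      using assms(3) by (simp add: abs_le_square_iff)
  qed measurable
qed (fact assms)

lemma L1_le_norm_L2:
  assumes "square_integrable f"
  shows "(LINT t|unit_lebesgue. \<bar>f t\<bar>) \<le> norm (abs_L2 f)"
proof -
  have sq1: "square_integrable (\<lambda>_. 1)" by (rule square_integrable_bounded[where B = 1]) auto
  have sqa: "square_integrable (\<lambda>t. \<bar>f t\<bar>)"
    using assms by (auto simp: square_integrable_def)
  have "(norm (abs_L2 (\<lambda>_. 1)))\<^sup>2 = 1"
    unfolding norm_abs_L2[OF sq1] by (simp add: measure_restrict_space)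
  then have n1: "norm (abs_L2 (\<lambda>_. 1)) = 1" 
    by (metis norm_ge_zero power2_eq_1_iff less_eq_real_def neg_0_le_iff_le not_one_le_zero)
  have "(norm (abs_L2 (\<lambda>t. \<bar>f t\<bar>)))\<^sup>2 = (norm (abs_L2 f))\<^sup>2"
    unfolding norm_abs_L2[OF sqa] norm_abs_L2[OF assms] by simp
  then have n2: "norm (abs_L2 (\<lambda>t. \<bar>f t\<bar>)) = norm (abs_L2 f)"
    by (simp add: power2_eq_iff_nonneg)
  have "(LINT t|unit_lebesgue. \<bar>f t\<bar>) = inner (abs_L2 (\<lambda>t. \<bar>f t\<bar>)) (abs_L2 (\<lambda>_. 1))"
    by (simp add: inner_abs_L2 sqa sq1)
  also have "\<dots> \<le> norm (abs_L2 f)"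
    using norm_cauchy_schwarz[of "abs_L2 (\<lambda>t. \<bar>f t\<bar>)" "abs_L2 (\<lambda>_. 1)"] by (simp add: n1 n2)
  finally show ?thesis .
qed

instance L2 :: complete_space
proof
  fix X :: "nat \<Rightarrow> L2" assume "Cauchy X"
  define f where "f n = rep_L2 (X n)" for n
  have sq: "square_integrable (f n)" for n unfolding f_def by (rule square_integrable_rep)
  have [measurable]: "f n \<in> borel_measurable unit_lebesgue" for n
    using sq by (rule square_integrable_measurable)
  have Xf: "X n = abs_L2 (f n)" for n by (simp add: f_def abs_rep_L2)
  have int: "integrable unit_lebesgue (f n)" for n
    using square_integrable_mult[OF sq square_integrable_bounded[of "\<lambda>_. 1" 1]] by simp
  have norm_diff: "norm (X i - X j) = norm (abs_L2 (\<lambda>t. f i t - f j t))" for i j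
    by (simp add: Xf abs_L2_diff sq)
  have L1: "(LINT t|unit_lebesgue. norm (f i t - f j t)) \<le> norm (X i - X j)" for i j
    using L1_le_norm_L2[OF square_integrable_diff[OF sq sq, of i j]] by (simp add: norm_diff)
  obtain r where r: "strict_mono r" "AE t in unit_lebesgue. Cauchy (\<lambda>i. f (r i) t)"
  proof (rule cauchy_L1_AE_cauchy_subseq[of unit_lebesgue f])
    show "\<exists>N. \<forall>i\<ge>N. \<forall>j\<ge>N. (LINT t|unit_lebesgue. norm (f i t - f j t)) < e" if "0 < e" for e
      using \<open>Cauchy X\<close> that L1 unfolding Cauchy_def dist_norm by (meson order_le_less_trans)
  qed (use int in auto)
  define g where "g t = lim (\<lambda>i. f (r i) t)" for t
  have [measurable]: "g \<in> borel_measurable unit_lebesgue"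
    unfolding g_def by measurable
  have conv: "AE t in unit_lebesgue. (\<lambda>i. f (r i) t) \<longlonglongrightarrow> g t"
    using r(2) unfolding g_def by eventually_elim (simp add: Cauchy_convergent_iff convergent_LIMSEQ_iff)
  have bound: "\<exists>N. \<forall>n\<ge>N. (\<integral>\<^sup>+t. ennreal ((g t - f n t)\<^sup>2) \<partial>unit_lebesgue) \<le> ennreal (e\<^sup>2)"
    if "0 < e" for e
  proof -
    obtain N where N: "norm (X i - X j) < e" if "i \<ge> N" "j \<ge> N" for i j
      using \<open>Cauchy X\<close> \<open>0 < e\<close> unfolding Cauchy_def dist_norm by meson
    have "(\<integral>\<^sup>+t. ennreal ((g t - f n t)\<^sup>2) \<partial>unit_lebesgue) \<le> ennreal (e\<^sup>2)" if "n \<ge> N" for n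
    proof -
      have "(\<integral>\<^sup>+t. ennreal ((g t - f n t)\<^sup>2) \<partial>unit_lebesgue)
          = (\<integral>\<^sup>+t. liminf (\<lambda>k. ennreal ((f (r k) t - f n t)\<^sup>2)) \<partial>unit_lebesgue)"
      proof (rule nn_integral_cong_AE, use conv in eventually_elim)
        case (elim t)
        then have "(\<lambda>k. ennreal ((f (r k) t - f n t)\<^sup>2)) \<longlonglongrightarrow> ennreal ((g t - f n t)\<^sup>2)"
          by (intro tendsto_intros) 
        from lim_imp_Liminf[OF _ this] show ?case by simp
      qed
      also have "\<dots> \<le> liminf (\<lambda>k. \<integral>\<^sup>+t. ennreal ((f (r k) t - f n t)\<^sup>2) \<partial>unit_lebesgue)"
        by (rule nn_integral_liminf) measurable
      also have "\<dots> \<le> limsup (\<lambda>k. \<integral>\<^sup>+t. ennreal ((f (r k) t - f n t)\<^sup>2) \<partial>unit_lebesgue)"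
        by (rule Liminf_le_Limsup) simp
      also have "\<dots> \<le> ennreal (e\<^sup>2)"
      proof (rule Limsup_bounded, rule eventually_sequentiallyI[of N])
        fix k assume "N \<le> k"
        then have "N \<le> r k" using seq_suble[OF r(1), of k] by simp
        have sqd: "square_integrable (\<lambda>t. f (r k) t - f n t)"
          by (rule square_integrable_diff[OF sq sq])
        have "(\<integral>\<^sup>+t. ennreal ((f (r k) t - f n t)\<^sup>2) \<partial>unit_lebesgue)
            = ennreal (LINT t|unit_lebesgue. (f (r k) t - f n t)\<^sup>2)"
          using sqd by (intro nn_integral_eq_integral) (auto simp: square_integrable_def)
        also have "\<dots> = ennreal ((norm (X (r k) - X n))\<^sup>2)"
          by (simp add: norm_diff norm_abs_L2[OF sqd])
        also have "\<dots> \<le> ennreal (e\<^sup>2)"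
          using N[OF \<open>N \<le> r k\<close> \<open>n \<ge> N\<close>] by (intro ennreal_leI power_mono) auto
        finally show "(\<integral>\<^sup>+t. ennreal ((f (r k) t - f n t)\<^sup>2) \<partial>unit_lebesgue) \<le> ennreal (e\<^sup>2)" .
      qed
      finally show ?thesis .
    qed
    then show ?thesis by blast
  qed
  have sqd: "square_integrable (\<lambda>t. g t - f n t)"
    if "(\<integral>\<^sup>+t. ennreal ((g t - f n t)\<^sup>2) \<partial>unit_lebesgue) \<le> ennreal (e\<^sup>2)" for n e
    unfolding square_integrable_def
    using that by (auto intro!: integrableI_nonneg order.strict_trans1[OF that])
  have sqg: "square_integrable g"
  proof -
    obtain n where "(\<integral>\<^sup>+t. ennreal ((g t - f n t)\<^sup>2) \<partial>unit_lebesgue) \<le> ennreal (1\<^sup>2)"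
      using bound[of 1] by auto
    then show ?thesis using square_integrable_add[OF sqd sq, of n 1 n] by simp
  qed
  have "X \<longlonglongrightarrow> abs_L2 g"
  proof (rule metric_LIMSEQ_I)
    fix e :: real assume "0 < e"
    then obtain N where N: "\<And>n. n \<ge> N \<Longrightarrow>
        (\<integral>\<^sup>+t. ennreal ((g t - f n t)\<^sup>2) \<partial>unit_lebesgue) \<le> ennreal ((e/2)\<^sup>2)"
      using bound[of "e/2"] by auto
    have "dist (X n) (abs_L2 g) < e" if "n \<ge> N" for n
    proof -
      have "ennreal (LINT t|unit_lebesgue. (g t - f n t)\<^sup>2) \<le> ennreal ((e/2)\<^sup>2)"
        using N[OF that] sqd[OF N[OF that]]
        by (subst nn_integral_eq_integral[symmetric]) (auto simp: square_integrable_def)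
      then have "(LINT t|unit_lebesgue. (g t - f n t)\<^sup>2) \<le> (e/2)\<^sup>2"
        by (simp add: ennreal_le_iff)
      then have "(norm (abs_L2 g - X n))\<^sup>2 \<le> (e/2)\<^sup>2"
        by (simp add: Xf abs_L2_diff sqg sq norm_abs_L2[OF sqd[OF N[OF that]]])
      then have "norm (abs_L2 g - X n) \<le> e/2"
        using \<open>0 < e\<close> by (meson half_gt_zero less_eq_real_def power2_le_imp_le)
      then show ?thesis using \<open>0 < e\<close> by (simp add: dist_norm norm_minus_commute)
    qed
    then show "\<exists>N. \<forall>n\<ge>N. dist (X n) (abs_L2 g) < e" by blast
  qed
  then show "convergent X" by (auto simp: convergent_def)
qed

instance L2 :: banach ..

subsection \<open>Separability\<close>

definition rational_span :: "'a::real_vector set \<Rightarrow> 'a set"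
  where "rational_span G = (\<lambda>l. \<Sum>(q, e)\<leftarrow>l. of_rat q *\<^sub>R e) ` lists (UNIV \<times> G)"

lemma countable_rational_span: "countable G \<Longrightarrow> countable (rational_span G)"
  unfolding rational_span_def by (intro countable_image countable_lists countable_SIGMA) auto

lemma rational_span_0: "0 \<in> rational_span G"
  unfolding rational_span_def by (rule image_eqI[of _ _ "[]"]) auto

lemma rational_span_base: "e \<in> G \<Longrightarrow> e \<in> rational_span G"
  unfolding rational_span_def by (rule image_eqI[of _ _ "[(1, e)]"]) auto

lemma rational_span_add:
  assumes "x \<in> rational_span G" "y \<in> rational_span G"
  shows "x + y \<in> rational_span G"
proof -
  obtain k l where "k \<in> lists (UNIV \<times> G)" "l \<in> lists (UNIV \<times> G)"
    "x = (\<Sum>(q, e)\<leftarrow>k. of_rat q *\<^sub>R e)" "y = (\<Sum>(q, e)\<leftarrow>l. of_rat q *\<^sub>R e)"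
    using assms unfolding rational_span_def by auto
  then show ?thesis unfolding rational_span_def by (intro image_eqI[of _ _ "k @ l"]) auto
qed

lemma rational_span_scale:
  assumes "x \<in> rational_span G"
  shows "of_rat c *\<^sub>R x \<in> rational_span G"
proof -
  obtain l where l: "l \<in> lists (UNIV \<times> G)" "x = (\<Sum>(q, e)\<leftarrow>l. of_rat q *\<^sub>R e)"
    using assms unfolding rational_span_def by auto
  have "of_rat c *\<^sub>R x = (\<Sum>(q, e)\<leftarrow>map (\<lambda>(q, e). (c * q, e)) l. of_rat q *\<^sub>R e)"
    unfolding l(2) by (induction l) (auto simp: scaleR_add_right of_rat_mult)
  moreover have "map (\<lambda>(q, e). (c * q, e)) l \<in> lists (UNIV \<times> G)"
    using l(1) by (auto simp: in_lists_conv_set)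
  ultimately show ?thesis unfolding rational_span_def by blast
qed

lemma subspace_closure_rational_span:
  fixes G :: "'a::real_normed_vector set"
  shows "subspace (closure (rational_span G))"
proof (rule subspaceI)
  show "0 \<in> closure (rational_span G)"
    using rational_span_0 closure_subset by blast
next
  fix x y assume "x \<in> closure (rational_span G)" "y \<in> closure (rational_span G)"
  then obtain u v where "\<forall>n. u n \<in> rational_span G" "u \<longlonglongrightarrow> x" "\<forall>n. v n \<in> rational_span G" "v \<longlonglongrightarrow> y"
    unfolding closure_sequential by blast
  then show "x + y \<in> closure (rational_span G)"
    unfolding closure_sequential
    by (intro exI[of _ "\<lambda>n. u n + v n"]) (auto intro: rational_span_add tendsto_add)
next
  fix c :: real and x assume "x \<in> closure (rational_span G)"
  then obtain u where u: "\<And>n. u n \<in> rational_span G" "u \<longlonglongrightarrow> x"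
    unfolding closure_sequential by blast
  have "\<exists>q. \<bar>of_rat q - c\<bar> < inverse (real (Suc n))" for n
  proof -
    obtain s where "s \<in> \<rat>" "c < s" "s < c + inverse (real (Suc n))"
      using Rats_dense_in_real[of c "c + inverse (real (Suc n))"] by auto
    then obtain q where "s = of_rat q" by (auto simp: Rats_def)
    then have "\<bar>of_rat q - c\<bar> < inverse (real (Suc n))"
      using \<open>c < s\<close> \<open>s < c + inverse (real (Suc n))\<close> by linarith
    then show ?thesis by blast
  qed
  then obtain q where q: "\<And>n. \<bar>of_rat (q n) - c\<bar> < inverse (real (Suc n))" by metis
  have "(\<lambda>n. of_rat (q n) - c) \<longlonglongrightarrow> 0"
    by (rule Lim_null_comparison[OF _ LIMSEQ_inverse_real_of_nat])
      (use q in \<open>auto intro!: always_eventually less_imp_le\<close>)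
  then have "(\<lambda>n. of_rat (q n) :: real) \<longlonglongrightarrow> c" by (simp add: LIM_zero_iff)
  then have "(\<lambda>n. of_rat (q n) *\<^sub>R u n) \<longlonglongrightarrow> c *\<^sub>R x" using u(2) by (rule tendsto_scaleR)
  then show "c *\<^sub>R x \<in> closure (rational_span G)"
    unfolding closure_sequential
    by (intro exI[of _ "\<lambda>n. of_rat (q n) *\<^sub>R u n"]) (auto intro: rational_span_scale u(1))
qed

lemma countable_borel_pi_system:
  obtains E :: "real set set" where "countable E" "Int_stable E" "UNIV \<in> E"
    "sets borel = sigma_sets UNIV E"
proof -
  obtain B :: "real set set" where B: "countable B" "topological_basis B"
    using ex_countable_basis by blast
  define E where "E = Inter ` {A. finite A \<and> A \<subseteq> B}"
  have "countable E"
    unfolding E_def using B(1) by (intro countable_image countable_Collect_finite_subset)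
  moreover have "Int_stable E"
  proof (rule Int_stableI)
    fix a b assume "a \<in> E" "b \<in> E"
    then obtain A A' where "finite A" "A \<subseteq> B" "a = \<Inter>A" "finite A'" "A' \<subseteq> B" "b = \<Inter>A'"
      by (auto simp: E_def)
    then show "a \<inter> b \<in> E" unfolding E_def by (intro image_eqI[of _ _ "A \<union> A'"]) auto
  qed
  moreover have "UNIV \<in> E" unfolding E_def by (rule image_eqI[of _ _ "{}"]) auto
  moreover have "sets borel = sigma_sets UNIV E"
  proof
    have "B \<subseteq> E"
    proof
      fix b assume "b \<in> B" then show "b \<in> E" unfolding E_def by (intro image_eqI[of _ _ "{b}"]) auto
    qed
    then show "sets borel \<subseteq> sigma_sets UNIV E"
      unfolding borel_eq_countable_basis[OF B] by (simp add: sigma_sets_mono')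
    have "E \<subseteq> sets borel"
    proof
      fix e assume "e \<in> E"
      then obtain A where "finite A" "A \<subseteq> B" "e = \<Inter>A" by (auto simp: E_def)
      then have "open e" using topological_basis_open[OF B(2)] by (auto intro!: open_Inter)
      then show "e \<in> sets borel" by simp
    qed
    then show "sigma_sets UNIV E \<subseteq> sets borel"
      using sets.sigma_sets_subset[of E borel] by simp
  qed
  ultimately show ?thesis using that by blast
qed

lemma LIMSEQ_abs_L2_dominated:
  assumes [measurable]: "\<And>n. u n \<in> borel_measurable unit_lebesgue"
    "v \<in> borel_measurable unit_lebesgue"
    and g: "square_integrable g" and bd: "\<And>n t. t \<in> {0..1} \<Longrightarrow> \<bar>u n t\<bar> \<le> \<bar>g t\<bar>"
    and lim: "\<And>t. t \<in> {0..1} \<Longrightarrow> (\<lambda>n. u n t) \<longlonglongrightarrow> v t"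
  shows "(\<lambda>n. abs_L2 (u n)) \<longlonglongrightarrow> abs_L2 v"
proof -
  have bdv: "\<bar>v t\<bar> \<le> \<bar>g t\<bar>" if "t \<in> {0..1}" for t
    using lim[OF that] bd[OF that] by (intro Lim_bounded[OF tendsto_rabs, of _ "v t" 0]) auto
  have squ: "square_integrable (u n)" for n
    by (rule square_integrable_dominated[OF _ g]) (auto intro!: AE_I2 bd)
  have sqv: "square_integrable v"
    by (rule square_integrable_dominated[OF _ g]) (auto intro!: AE_I2 bdv)
  have "(\<lambda>n. LINT t|unit_lebesgue. (u n t - v t)\<^sup>2) \<longlonglongrightarrow> (LINT t|unit_lebesgue. 0)"
  proof (rule integral_dominated_convergence)
    show "integrable unit_lebesgue (\<lambda>t. 4 * (g t)\<^sup>2)"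
      using g by (auto simp: square_integrable_def)
    show "AE t in unit_lebesgue. (\<lambda>n. (u n t - v t)\<^sup>2) \<longlonglongrightarrow> 0"
    proof (rule AE_I2)
      fix t assume "t \<in> space unit_lebesgue"
      then have "(\<lambda>n. (u n t - v t)\<^sup>2) \<longlonglongrightarrow> (v t - v t)\<^sup>2"
        by (intro tendsto_intros lim) auto
      then show "(\<lambda>n. (u n t - v t)\<^sup>2) \<longlonglongrightarrow> 0" by simp
    qed
    show "AE t in unit_lebesgue. norm ((u n t - v t)\<^sup>2) \<le> 4 * (g t)\<^sup>2" for n
    proof (rule AE_I2)
      fix t assume "t \<in> space unit_lebesgue"
      then have "\<bar>u n t - v t\<bar> \<le> \<bar>2 * g t\<bar>"
        using bd[of t n] bdv[of t] by auto
      then have "(u n t - v t)\<^sup>2 \<le> (2 * g t)\<^sup>2" by (simp only: abs_le_square_iff)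
      then show "norm ((u n t - v t)\<^sup>2) \<le> 4 * (g t)\<^sup>2" by (simp add: power_mult_distrib)
    qed
  qed measurable
  then have "(\<lambda>n. (norm (abs_L2 (u n) - abs_L2 v))\<^sup>2) \<longlonglongrightarrow> 0"
    by (simp add: abs_L2_diff squ sqv norm_abs_L2 square_integrable_diff)
  then have "(\<lambda>n. sqrt ((norm (abs_L2 (u n) - abs_L2 v))\<^sup>2)) \<longlonglongrightarrow> sqrt 0"
    by (rule tendsto_real_sqrt)
  then have "(\<lambda>n. norm (abs_L2 (u n) - abs_L2 v)) \<longlonglongrightarrow> 0" by simp
  then show ?thesis by (simp add: tendsto_norm_zero_iff LIM_zero_iff)
qed

lemma square_integrable_indicator:
  "A \<in> sets unit_lebesgue \<Longrightarrow> square_integrable (indicator A)"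
  by (rule square_integrable_bounded[where B = 1]) (auto simp: indicator_def)

lemma square_integrable_indicator_borel:
  fixes A :: "real set"
  assumes "A \<in> sets borel"
  shows "square_integrable (indicator A)"
  using assms
  by (intro square_integrable_bounded[where B = 1] measurable_restrict_space1 measurable_completion)
    (auto simp: indicator_def)

lemma abs_L2_indicator_empty: "abs_L2 (indicator {}) = 0"
proof -
  have "(indicator {} :: real \<Rightarrow> real) = (\<lambda>_. 0)" by auto
  then show ?thesis by (simp add: zero_L2_def)
qed

lemma closed_subspace_L2_eq_UNIV:
  assumes V: "closed V" "subspace V" and E: "Int_stable E" "UNIV \<in> E" "sets borel = sigma_sets UNIV E"
    and base: "\<And>e. e \<in> E \<Longrightarrow> abs_L2 (indicator e) \<in> V"
  shows "V = UNIV"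
proof -
  have EB: "A \<in> sets borel" if "A \<in> sigma_sets UNIV E" for A using that E(3) by simp
  have EP: "E \<subseteq> Pow UNIV" by simp
  have borel: "abs_L2 (indicator A) \<in> V" if "A \<in> sets borel" for A
  proof -
    have "A \<in> sigma_sets UNIV E" using that E(3) by simp
    then show ?thesis
    proof (induction rule: sigma_sets_induct_disjoint[OF E(1) EP, consumes 1, case_names base empty compl union])
      case (base A)
      then show ?case by (rule assms)
    next
      case empty
      have "abs_L2 (indicator {}) \<in> V"
        unfolding abs_L2_indicator_empty by (rule subspace_0[OF V(2)])
      then show ?case .
    next
      case (compl A)
      have borelU: "(UNIV :: real set) \<in> sets borel" by simp
      have "abs_L2 (indicator (UNIV - A)) = abs_L2 (indicator UNIV) - abs_L2 (indicator A)"
      proof -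
        have eq: "indicator (UNIV - A) = (\<lambda>t. indicator UNIV t - indicator A t :: real)"
          by (auto simp: indicator_def)
        show ?thesis
          by (subst eq) (rule abs_L2_diff[OF square_integrable_indicator_borel[OF borelU]
              square_integrable_indicator_borel[OF EB[OF compl(1)]], symmetric])
      qed
      then show ?case
        by (rule ssubst) (rule subspace_diff[OF V(2) base[OF E(2)] compl(2)])
    next
      case (union A)
      have bor: "A i \<in> sets borel" for i using union(2) EB by auto
      have fin: "abs_L2 (indicator (\<Union>i<n. A i)) \<in> V" for n :: nat
      proof (induction n)
        case 0
        have "abs_L2 (indicator {}) \<in> V"
          unfolding abs_L2_indicator_empty by (rule subspace_0[OF V(2)])
        then show ?case by (simp only: lessThan_0 UN_empty)
      next
        case (Suc n)
        have "A i \<inter> A n = {}" if "i < n" for i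
          using union(1) that unfolding disjoint_family_on_def by simp
        then have disj: "t \<notin> A n" if "t \<in> (\<Union>i<n. A i)" for t
          using that by blast
        have eq: "indicator (\<Union>i<Suc n. A i) = (\<lambda>t. indicator (\<Union>i<n. A i) t + indicator (A n) t :: real)"
        proof
          fix t
          have "t \<in> (\<Union>i<Suc n. A i) \<longleftrightarrow> t \<in> (\<Union>i<n. A i) \<or> t \<in> A n"
            by (auto simp: lessThan_Suc)
          then show "indicator (\<Union>i<Suc n. A i) t = (indicator (\<Union>i<n. A i) t + indicator (A n) t :: real)"
            using disj[of t] unfolding indicator_def of_bool_def by argo
        qed
        have sq: "square_integrable (indicator (\<Union>i<n. A i))" "square_integrable (indicator (A n))"
          by (intro square_integrable_indicator_borel sets.finite_UN bor; simp)+
        have "abs_L2 (indicator (\<Union>i<Suc n. A i)) = abs_L2 (indicator (\<Union>i<n. A i)) + abs_L2 (indicator (A n))"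
          by (subst eq) (rule abs_L2_add[OF sq, symmetric])
        then show ?case
          by (rule ssubst) (rule subspace_add[OF V(2) Suc union(3)[of n]])
      qed
      have "(\<lambda>n. abs_L2 (indicator (\<Union>i<n. A i))) \<longlonglongrightarrow> abs_L2 (indicator (\<Union>i. A i))"
      proof (rule LIMSEQ_abs_L2_dominated[where g = "\<lambda>_. 1"])
        show "(indicator (\<Union>i<n. A i) :: real \<Rightarrow> real) \<in> borel_measurable unit_lebesgue" for n
          by (intro square_integrable_measurable square_integrable_indicator_borel sets.finite_UN bor) simp
        show "(indicator (\<Union>i. A i) :: real \<Rightarrow> real) \<in> borel_measurable unit_lebesgue"
          by (intro square_integrable_measurable square_integrable_indicator_borel sets.countable_UN) (use bor in auto)
        show "square_integrable (\<lambda>_. 1)" by (rule square_integrable_bounded[where B = 1]) auto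
        show "(\<lambda>n. indicator (\<Union>i<n. A i) t :: real) \<longlonglongrightarrow> indicator (\<Union>i. A i) t" for t
          by (rule LIMSEQ_indicator_UN)
      qed (auto simp: indicator_def)
      then show ?case by (rule closed_sequentially[OF V(1) fin])
    qed
  qed
  have leb: "abs_L2 (indicator A) \<in> V" if A: "A \<in> sets unit_lebesgue" for A
  proof -
    have "A \<in> sets lebesgue" using A by (auto simp: sets_restrict_space)
    then obtain S N N' where S: "A = S \<union> N" "N \<subseteq> N'" "N' \<in> null_sets lborel" "S \<in> sets lborel"
      by (rule sets_completionE)
    have "AE t in lebesgue. t \<notin> N'" using S(3) by (auto intro!: AE_not_in null_sets_completionI)
    then have "AE t in unit_lebesgue. t \<notin> N'" by (auto simp: AE_restrict_space_iff)
    then have "AE t in unit_lebesgue. indicator A t = (indicator S t :: real)"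
      by eventually_elim (use S(1,2) in \<open>auto simp: indicator_def\<close>)
    then have "abs_L2 (indicator A) = abs_L2 (indicator S)"
      using S(4) by (subst abs_L2_eq_iff)
        (auto intro: square_integrable_indicator[OF A] square_integrable_indicator_borel)
    then show ?thesis using borel S(4) by simp
  qed
  have nonneg: "square_integrable u \<longrightarrow> abs_L2 u \<in> V"
    if "u \<in> borel_measurable unit_lebesgue" "\<And>t. 0 \<le> u t" for u
    using that
  proof (induction rule: borel_measurable_induct_real)
    case (set A)
    then show ?case using leb by simp
  next
    case (mult u c)
    show ?case
    proof (cases "c = 0")
      case True
      have "abs_L2 (\<lambda>t. c * u t) = 0"
        using True by (simp add: zero_L2_def)
      then show ?thesis using subspace_0[OF V(2)] by simp
    next
      case False
      show ?thesis
      proof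
        assume "square_integrable (\<lambda>t. c * u t)"
        from square_integrable_scale[OF this, of "1/c"] have sq: "square_integrable u"
          using False by simp
        then have "abs_L2 (\<lambda>t. c * u t) = c *\<^sub>R abs_L2 u" by (simp add: abs_L2_scale)
        then show "abs_L2 (\<lambda>t. c * u t) \<in> V" using mult sq subspace_scale[OF V(2)] by simp
      qed
    qed
  next
    case (add u v)
    show ?case
    proof
      assume sq: "square_integrable (\<lambda>t. v t + u t)"
      have "square_integrable u" "square_integrable v"
        using add.hyps by (auto intro!: square_integrable_dominated[OF _ sq] AE_I2)
      then show "abs_L2 (\<lambda>t. v t + u t) \<in> V"
        using add subspace_add[OF V(2)] by (simp add: abs_L2_add[symmetric])
    qed
  next
    case (seq U)
    show ?case
    proof
      assume sq: "square_integrable u"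
      have le: "\<bar>U i t\<bar> \<le> \<bar>u t\<bar>" if "t \<in> {0..1}" for i t
      proof -
        have "incseq (\<lambda>i. U i t)" using seq.hyps by (auto simp: incseq_def le_fun_def)
        moreover have "(\<lambda>i. U i t) \<longlonglongrightarrow> u t" using seq.hyps that by simp
        ultimately have "U i t \<le> u t" by (rule incseq_le)
        then show ?thesis using seq.hyps(2)[of i t] by simp
      qed
      have "square_integrable (U i)" for i
        using seq.hyps(1) by (intro square_integrable_dominated[OF _ sq] AE_I2) (auto intro: le)
      then have "abs_L2 (U i) \<in> V" for i using seq.IH by blast
      note UV = this
      have "(\<lambda>i. abs_L2 (U i)) \<longlonglongrightarrow> abs_L2 u"
        using seq.hyps le sq
        by (intro LIMSEQ_abs_L2_dominated[where g = u]) (auto intro: square_integrable_measurable)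
      then show "abs_L2 u \<in> V" by (rule closed_sequentially[OF V(1) UV])
    qed
  qed
  have "x \<in> V" for x
  proof -
    define f where "f = rep_L2 x"
    have sq: "square_integrable f" unfolding f_def by (rule square_integrable_rep)
    have [measurable]: "f \<in> borel_measurable unit_lebesgue" using sq by (rule square_integrable_measurable)
    have p: "square_integrable (\<lambda>t. max 0 (f t))" and n: "square_integrable (\<lambda>t. max 0 (- f t))"
      by (auto intro!: square_integrable_dominated[OF _ sq])
    have "x = abs_L2 (\<lambda>t. max 0 (f t) - max 0 (- f t))"
    proof -
      have "(\<lambda>t. max 0 (f t) - max 0 (- f t)) = f" by (auto simp: max_def)
      then show ?thesis by (simp add: f_def abs_rep_L2)
    qed
    also have "\<dots> = abs_L2 (\<lambda>t. max 0 (f t)) - abs_L2 (\<lambda>t. max 0 (- f t))"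
      using p n by (simp add: abs_L2_diff)
    finally show ?thesis
      using p n nonneg[of "\<lambda>t. max 0 (f t)"] nonneg[of "\<lambda>t. max 0 (- f t)"]
      by (auto intro!: subspace_diff[OF V(2)])
  qed
  then show ?thesis by auto
qed

lemma countable_dense_L2: "\<exists>D :: L2 set. countable D \<and> closure D = UNIV"
proof -
  obtain E :: "real set set" where E: "countable E" "Int_stable E" "UNIV \<in> E"
    "sets borel = sigma_sets UNIV E" by (rule countable_borel_pi_system)
  let ?D = "rational_span ((\<lambda>e. abs_L2 (indicator e)) ` E)"
  have "closure ?D = UNIV"
    using E(2-4) by (intro closed_subspace_L2_eq_UNIV[of _ E] subspace_closure_rational_span)
      (auto intro!: closure_subset[THEN subsetD] rational_span_base)
  moreover have "countable ?D" using E(1) by (intro countable_rational_span countable_image)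
  ultimately show ?thesis by blast
qed

instance L2 :: second_countable_topology
proof
  obtain D :: "L2 set" where D: "countable D" "closure D = UNIV"
    using countable_dense_L2 by blast
  let ?B = "(\<lambda>(d, n). ball d (inverse (real (Suc n)))) ` (D \<times> UNIV)"
  have "topological_basis ?B"
  proof (rule topological_basisI)
    fix U and x :: L2 assume "open U" "x \<in> U"
    then obtain e where e: "0 < e" "ball x e \<subseteq> U" by (auto simp: open_contains_ball)
    obtain n where n: "inverse (real (Suc n)) < e / 2"
      using reals_Archimedean[of "e/2"] e(1) by auto
    have "x \<in> closure D" using D(2) by simp
    then obtain d where d: "d \<in> D" "dist d x < inverse (real (Suc n))"
      unfolding closure_approachable by (metis inverse_positive_iff_positive of_nat_0_less_iff zero_less_Suc)
    have "ball d (inverse (real (Suc n))) \<subseteq> ball x e"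
    proof
      fix y assume "y \<in> ball d (inverse (real (Suc n)))"
      then show "y \<in> ball x e"
        using dist_triangle[of x y d] d(2) n by (simp add: dist_commute)
    qed
    then show "\<exists>b\<in>?B. x \<in> b \<and> b \<subseteq> U"
      using d e(2) by (intro bexI[of _ "ball d (inverse (real (Suc n)))"]) auto
  qed auto
  then have "open = generate_topology ?B" by (rule topological_basis_imp_subbasis)
  moreover have "countable ?B" using D(1) by (intro countable_image countable_SIGMA) auto
  ultimately show "\<exists>B :: L2 set set. countable B \<and> open = generate_topology B" by blast
qed

instance L2 :: polish_space ..

section \<open>The test statistic and its population counterparts\<close>

definition gauss_cf :: "L2 \<Rightarrow> (L2 \<Rightarrow> L2) \<Rightarrow> L2 \<Rightarrow> complex"
  where "gauss_cf m K f = exp (\<i> * of_real (inner m f) - of_real (inner (K f) f) / 2)"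

text \<open>
  A sample is a sequence \<open>x\<close>, of which the entries \<open>x 1, \<dots>, x n\<close> are used.
\<close>

definition sample_mean :: "(nat \<Rightarrow> L2) \<Rightarrow> nat \<Rightarrow> L2"
  where "sample_mean x n = (1 / real n) *\<^sub>R (\<Sum>j=1..n. x j)"

definition sample_cov_kernel :: "(nat \<Rightarrow> L2) \<Rightarrow> nat \<Rightarrow> real \<Rightarrow> real \<Rightarrow> real"
  where "sample_cov_kernel x n s t = (1 / real n) *
    (\<Sum>j=1..n. (rep_L2 (x j) s - rep_L2 (sample_mean x n) s) *
               (rep_L2 (x j) t - rep_L2 (sample_mean x n) t))"

definition sample_cov :: "(nat \<Rightarrow> L2) \<Rightarrow> nat \<Rightarrow> L2 \<Rightarrow> L2"
  where "sample_cov x n f =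
    abs_L2 (\<lambda>s. LINT t|unit_lebesgue. sample_cov_kernel x n s t * rep_L2 f t)"

text \<open>
  \<^const>\<open>sample_cov\<close> picks representatives; the next two lemmas show that \<^const>\<open>abs_L2\<close> is applied
  to a square-integrable function there and that the result does not depend on the choice.
\<close>

lemma sum_abs_L2:
  assumes "finite J" "\<And>j. j \<in> J \<Longrightarrow> square_integrable (h j)"
  shows "square_integrable (\<lambda>s. \<Sum>j\<in>J. h j s) \<and> (\<Sum>j\<in>J. abs_L2 (h j)) = abs_L2 (\<lambda>s. \<Sum>j\<in>J. h j s)"
  using assms
  by (induction J rule: finite_induct)
    (auto simp: square_integrable_zero zero_L2_def square_integrable_add abs_L2_add)

lemma sample_cov_eq:
  "square_integrable (\<lambda>s. LINT t|unit_lebesgue. sample_cov_kernel x n s t * rep_L2 f t)" (is ?sq)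
  "sample_cov x n f = (1 / real n) *\<^sub>R
    (\<Sum>j=1..n. inner (x j - sample_mean x n) f *\<^sub>R (x j - sample_mean x n))" (is ?eq)
proof -
  define d where "d j s = rep_L2 (x j) s - rep_L2 (sample_mean x n) s" for j s
  have sqd: "square_integrable (d j)" for j
    unfolding d_def by (intro square_integrable_diff square_integrable_rep)
  have d: "abs_L2 (d j) = x j - sample_mean x n" for j
    using abs_L2_diff[OF square_integrable_rep square_integrable_rep, of "x j" "sample_mean x n"]
    by (simp add: abs_rep_L2 d_def[abs_def])
  have inner: "(LINT t|unit_lebesgue. d j t * rep_L2 f t) = inner (x j - sample_mean x n) f" for j
    using inner_abs_L2[OF sqd[of j] square_integrable_rep[of f]] by (simp add: d abs_rep_L2)
  define h where "h j s = inner (x j - sample_mean x n) f * d j s" for j s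
  have sqh: "square_integrable (h j)" for j
    unfolding h_def by (intro square_integrable_scale sqd)
  have *: "(LINT t|unit_lebesgue. sample_cov_kernel x n s t * rep_L2 f t)
      = (1 / real n) * (\<Sum>j=1..n. h j s)" for s
  proof -
    have "(LINT t|unit_lebesgue. sample_cov_kernel x n s t * rep_L2 f t)
        = (LINT t|unit_lebesgue. (1 / real n) * (\<Sum>j=1..n. d j s * (d j t * rep_L2 f t)))"
      by (simp add: sample_cov_kernel_def d_def sum_distrib_right mult.assoc)
    also have "\<dots> = (1 / real n) * (\<Sum>j=1..n. LINT t|unit_lebesgue. d j s * (d j t * rep_L2 f t))"
      by (subst integral_mult_right_zero, subst Bochner_Integration.integral_sum)
        (auto intro!: integrable_mult_right square_integrable_mult sqd square_integrable_rep)
    also have "\<dots> = (1 / real n) * (\<Sum>j=1..n. h j s)"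
      by (simp add: inner h_def mult.commute[of "d _ s"])
    finally show ?thesis .
  qed
  have sum: "square_integrable (\<lambda>s. \<Sum>j=1..n. h j s)"
      "(\<Sum>j=1..n. abs_L2 (h j)) = abs_L2 (\<lambda>s. \<Sum>j=1..n. h j s)"
    using sum_abs_L2[of "{1..n}" h] sqh by auto
  show ?sq unfolding * by (rule square_integrable_scale[OF sum(1)])
  show ?eq
    unfolding sample_cov_def * abs_L2_scale[OF sum(1), symmetric] sum(2)[symmetric]
    by (simp add: h_def[abs_def] abs_L2_scale[OF sqd, symmetric] d)
qed

definition empirical_cf :: "(nat \<Rightarrow> L2) \<Rightarrow> nat \<Rightarrow> L2 \<Rightarrow> complex"
  where "empirical_cf x n f = (1 / of_nat n) * (\<Sum>j=1..n. exp (\<i> * of_real (inner f (x j))))"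

definition T_stat :: "L2 measure \<Rightarrow> (nat \<Rightarrow> L2) \<Rightarrow> nat \<Rightarrow> real"
  where "T_stat Q x n =
    (LINT f|Q. (cmod (empirical_cf x n f - gauss_cf (sample_mean x n) (sample_cov x n) f))\<^sup>2)"

definition cov_op :: "'w measure \<Rightarrow> ('w \<Rightarrow> L2) \<Rightarrow> L2 \<Rightarrow> L2"
  where "cov_op M X f = (LINT \<omega>|M. inner (X \<omega> - (LINT \<omega>'|M. X \<omega>')) f *\<^sub>R X \<omega>)"

definition char_functional :: "'w measure \<Rightarrow> ('w \<Rightarrow> L2) \<Rightarrow> L2 \<Rightarrow> complex"
  where "char_functional M X f = (LINT \<omega>|M. exp (\<i> * of_real (inner (X \<omega>) f)))"

definition tau :: "L2 measure \<Rightarrow> 'w measure \<Rightarrow> ('w \<Rightarrow> L2) \<Rightarrow> real"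
  where "tau Q M X =
    (LINT f|Q. (cmod (char_functional M X f - gauss_cf (LINT \<omega>|M. X \<omega>) (cov_op M X) f))\<^sup>2)"

definition sigma2 :: "'w measure \<Rightarrow> ('w \<Rightarrow> L2) \<Rightarrow> L2 \<Rightarrow> real"
  where "sigma2 M X f = inner (cov_op M X f) f"

definition z_fun :: "'w measure \<Rightarrow> ('w \<Rightarrow> L2) \<Rightarrow> L2 \<Rightarrow> real"
  where "z_fun M X f =
    (LINT \<omega>|M. cos (inner f (X \<omega>))) + (LINT \<omega>|M. sin (inner f (X \<omega>))) - exp (- sigma2 M X f / 2)"

definition xi :: "'w measure \<Rightarrow> ('w \<Rightarrow> L2) \<Rightarrow> L2 \<Rightarrow> L2 \<Rightarrow> real"
  where "xi M X f x =
    cos (inner f x) - (LINT \<omega>|M. cos (inner f (X \<omega>)))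
    + sin (inner f x) - (LINT \<omega>|M. sin (inner f (X \<omega>)))
    + inner f x * (LINT \<omega>|M. sin (inner f (X \<omega>)) - cos (inner f (X \<omega>)))
    + 1 / 2 * exp (- sigma2 M X f / 2) * ((inner f x)\<^sup>2 - sigma2 M X f)"

definition K_star :: "'w measure \<Rightarrow> ('w \<Rightarrow> L2) \<Rightarrow> L2 \<Rightarrow> L2 \<Rightarrow> real"
  where "K_star M X f g = (LINT \<omega>|M. xi M X f (X \<omega>) * xi M X g (X \<omega>))"

text \<open>
  The centred normal distribution with variance \<open>v \<ge> 0\<close>. The library's \<^const>\<open>normal_density\<close> takes
  the standard deviation and does not cover the degenerate case.
\<close>

definition centred_normal :: "real \<Rightarrow> real measure"
  where "centred_normal v =
    (if v = 0 then return borel 0 else density lborel (normal_density 0 (sqrt v)))"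

end

theory Submission
  imports Defs
begin

text \<open>
  Centring the sample does not change the modulus in the statistic, and the symmetry of \<open>Q\<close> removes the
  product of the even and the odd part, so that \<open>T\<^sub>n = \<integral> D\<^sub>n(f)\<^sup>2 Q(df)\<close> and \<open>\<tau>\<^sub>Q = \<integral> z(f)\<^sup>2 Q(df)\<close> for
  \<open>D\<^sub>n(f) = n\<^sup>-\<^sup>1 \<Sum> (cos + sin)\<langle>f, X\<^sub>j - m\<^sub>n\<rangle> - exp (- \<langle>C\<^sub>n f, f\<rangle> / 2)\<close>, \<open>m\<^sub>n\<close> the sample mean. A pathwise Taylor expansion gives
  \<open>\<bar>D\<^sub>n(f) - z(f) - n\<^sup>-\<^sup>1 \<Sum> \<xi>(f, X\<^sub>j)\<bar> \<le> 3 B\<^sub>n(f)\<close> and \<open>(D\<^sub>n(f) - z(f))\<^sup>2 \<le> 27 B\<^sub>n(f)\<close>, where \<open>B\<^sub>n(f)\<close>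
  is a sum of four squared centred sample means and hence has expectation of order \<open>(1 + \<parallel>f\<parallel>\<^sup>4) / n\<close>.
  Therefore \<open>\<surd>n (T\<^sub>n - \<tau>\<^sub>Q)\<close> differs from \<open>n\<^sup>-\<^sup>1\<^sup>/\<^sup>2 \<Sum> \<eta>(X\<^sub>j)\<close>, \<open>\<eta>(x) = 2 \<integral> z(f) \<xi>(f, x) Q(df)\<close>, by
  \<open>O(n\<^sup>-\<^sup>1\<^sup>/\<^sup>2)\<close> in mean. The real central limit theorem applies to the latter, the variance of \<open>\<eta>(X)\<close> is
  \<open>\<sigma>\<^sup>2\<close> by Fubini, and Levy's continuity theorem transfers the limit; no limit theorem in the Hilbert
  space is needed.
\<close>

section \<open>Elementary estimates\<close>

text \<open>
  The Hartley kernel. It merges the real and imaginary parts of characteristic functions into one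
  real quantity; its derivative at \<open>t\<close> is \<open>cas (- t)\<close>.
\<close>

definition cas :: "real \<Rightarrow> real"
  where "cas t = cos t + sin t"

lemma cas_measurable [measurable]: "cas \<in> borel_measurable borel"
  unfolding cas_def[abs_def] by measurable

lemma abs_cas_le: "\<bar>cas t\<bar> \<le> 2"
  unfolding cas_def using abs_cos_le_one[of t] abs_sin_le_one[of t] by linarith

lemma cas_diff_expansion: "cas (a - u) = cas a * cos u - cas (- a) * sin u"
  by (simp add: cas_def cos_diff sin_diff algebra_simps)

lemma abs_sin_diff_arg_le: "\<bar>sin u - u\<bar> \<le> u\<^sup>2 / 2" for u :: real
  using Maclaurin_sin_bound[of u 2] by (simp add: numeral_2_eq_2 sin_coeff_def)

lemma abs_cos_diff_one_le: "\<bar>cos u - 1\<bar> \<le> u\<^sup>2 / 2" for u :: real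
proof -
  have "cos u - 1 = - (2 * (sin (u / 2))\<^sup>2)"
    using cos_double_sin[of "u / 2"] by simp
  moreover have "(sin (u / 2))\<^sup>2 \<le> (u / 2)\<^sup>2"
    using abs_sin_x_le_abs_x[of "u / 2"] by (simp only: abs_le_square_iff)
  ultimately show ?thesis by (simp add: power_divide)
qed

lemma cas_lipschitz: "\<bar>cas a - cas b\<bar> \<le> 2 * \<bar>a - b\<bar>"
proof -
  have "\<bar>sin a - sin b\<bar> \<le> \<bar>a - b\<bar>" "\<bar>cos a - cos b\<bar> \<le> \<bar>a - b\<bar>"
    \<comment> \<open>By the sum-to-product formulas each difference is twice a half-angle sine,
      bounded by half of \<open>\<bar>a - b\<bar>\<close>, times a factor of modulus at most
      1.\<close>
    using mult_mono[OF abs_sin_x_le_abs_x[of "(a - b) / 2"] abs_cos_le_one[of "(a + b) / 2"]]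
      mult_mono[OF abs_sin_x_le_abs_x[of "(b - a) / 2"] abs_sin_le_one[of "(a + b) / 2"]]
    by (auto simp: sin_diff_sin cos_diff_cos abs_mult ac_simps abs_minus_commute)
  then show ?thesis unfolding cas_def by (smt (verit))
qed

text \<open>The angle expansion splits the remainder into \<open>cos u - 1\<close> and
  \<open>sin u - u\<close>, each at most \<open>u\<^sup>2 / 2\<close> in modulus and multiplied by a
  value of \<open>cas\<close>, which is at most 2 in modulus.\<close>

lemma cas_taylor: "\<bar>cas (a - u) - cas a + u * cas (- a)\<bar> \<le> 2 * u\<^sup>2"
proof -
  have "cas (a - u) - cas a + u * cas (- a) = cas a * (cos u - 1) - cas (- a) * (sin u - u)"
    unfolding cas_diff_expansion by (simp add: algebra_simps)
  moreover have "\<bar>cas a * (cos u - 1)\<bar> \<le> 2 * (u\<^sup>2 / 2)" "\<bar>cas (- a) * (sin u - u)\<bar> \<le> 2 * (u\<^sup>2 / 2)"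
    unfolding abs_mult by (intro mult_mono abs_cas_le abs_cos_diff_one_le abs_sin_diff_arg_le; simp)+
  ultimately show ?thesis by linarith
qed

text \<open>Convexity of \<open>exp (- t / 2)\<close>: the tangent at \<open>a\<close> stays below
  the graph. The Lipschitz and the Taylor bound below both rest on this.\<close>

lemma exp_tangent_le: "exp (- a / 2) - (b - a) / 2 * exp (- a / 2) \<le> exp (- b / 2)" for a b :: real
proof -
  have "exp (- a / 2) * (1 + (a - b) / 2) \<le> exp (- a / 2) * exp ((a - b) / 2)"
    by (intro mult_left_mono exp_ge_add_one_self) auto
  then show ?thesis by (simp add: mult_exp_exp algebra_simps diff_divide_distrib)
qed

lemma exp_half_lipschitz:
  fixes a b :: real assumes "0 \<le> a" "0 \<le> b"
  shows "\<bar>exp (- a / 2) - exp (- b / 2)\<bar> \<le> \<bar>a - b\<bar> / 2"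
proof -
  have *: "exp (- a / 2) - exp (- b / 2) \<le> \<bar>a - b\<bar> / 2" if "0 \<le> a" for a b :: real
  proof -
    have "exp (- a / 2) - exp (- b / 2) \<le> (b - a) / 2 * exp (- a / 2)"
      using exp_tangent_le[of a b] by simp
    also have "\<dots> \<le> \<bar>a - b\<bar> / 2 * 1"
      using that by (intro mult_mono) (auto simp: abs_if)
    finally show ?thesis by simp
  qed
  show ?thesis using *[OF assms(1), of b] *[OF assms(2), of a] by (smt (verit))
qed

lemma exp_half_taylor:
  fixes a b :: real assumes "0 \<le> a" "0 \<le> b"
  shows "\<bar>exp (- a / 2) - exp (- b / 2) + 1 / 2 * exp (- b / 2) * (a - b)\<bar> \<le> (a - b)\<^sup>2 / 4"
proof -
  let ?r = "exp (- a / 2) - exp (- b / 2) + 1 / 2 * exp (- b / 2) * (a - b)"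
  \<comment> \<open>The tangent at \<open>b\<close> bounds the remainder from below, the tangent at
    \<open>a\<close> from above; the upper bound is a product of two differences, so the Lipschitz
    bound makes it quadratic.\<close>
  have "0 \<le> ?r" using exp_tangent_le[of b a] by (simp add: algebra_simps)
  moreover have "?r \<le> (a - b) / 2 * (exp (- b / 2) - exp (- a / 2))"
    using exp_tangent_le[of a b] by (simp add: algebra_simps diff_divide_distrib)
  moreover have "(a - b) / 2 * (exp (- b / 2) - exp (- a / 2)) \<le> \<bar>a - b\<bar> / 2 * (\<bar>a - b\<bar> / 2)"
  proof -
    have "(a - b) / 2 * (exp (- b / 2) - exp (- a / 2)) \<le> \<bar>(a - b) / 2\<bar> * \<bar>exp (- b / 2) - exp (- a / 2)\<bar>"
      by (metis abs_ge_self abs_mult)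
    also have "\<dots> \<le> \<bar>a - b\<bar> / 2 * (\<bar>a - b\<bar> / 2)"
      using exp_half_lipschitz[OF assms(2,1)] by (intro mult_mono) (auto simp: abs_minus_commute)
    finally show ?thesis .
  qed
  ultimately have "\<bar>?r\<bar> \<le> \<bar>a - b\<bar> / 2 * (\<bar>a - b\<bar> / 2)" by linarith
  then show ?thesis by (simp add: power2_eq_square)
qed

text \<open>Lets fourth moments control second moments. The nonnegative sum in the proof equals
  \<open>2 * (1 + a ^ 4 - a\<^sup>2)\<close>.\<close>

lemma square_le_one_plus_fourth: "a\<^sup>2 \<le> 1 + a ^ 4" for a :: real
proof -
  have "0 \<le> (a\<^sup>2 - 1)\<^sup>2 + 1 + (a\<^sup>2)\<^sup>2" by simp
  then show ?thesis by (simp add: power2_diff power_mult[symmetric])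
qed

lemma inner_square_le: "(inner f x)\<^sup>2 \<le> (norm f)\<^sup>2 * (norm x)\<^sup>2" for f x :: "'a::real_inner"
  using Cauchy_Schwarz_ineq2[of f x] by (simp add: abs_le_square_iff[symmetric] power_mult_distrib[symmetric] abs_mult)

lemma inner_fourth_le: "((inner f x)\<^sup>2)\<^sup>2 \<le> norm f ^ 4 * norm x ^ 4" for f x :: "'a::real_inner"
  using power_mono[OF inner_square_le, of f x 2] by (simp add: power_mult_distrib power_mult[symmetric])

section \<open>The test statistic as a real-valued integral\<close>

text \<open>The integral of \<open>\<phi>\<close> against the empirical measure of the first
  \<open>n\<close> entries; it is 0 for \<open>n = 0\<close>.\<close>

definition emean :: "(nat \<Rightarrow> 'a) \<Rightarrow> nat \<Rightarrow> ('a \<Rightarrow> real) \<Rightarrow> real"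
  where "emean x n \<phi> = (1 / real n) * (\<Sum>j=1..n. \<phi> (x j))"

lemma emean_add: "emean x n (\<lambda>y. \<phi> y + \<psi> y) = emean x n \<phi> + emean x n \<psi>"
  by (simp add: emean_def sum.distrib algebra_simps add_divide_distrib)

lemma emean_diff: "emean x n (\<lambda>y. \<phi> y - \<psi> y) = emean x n \<phi> - emean x n \<psi>"
  by (simp add: emean_def sum_subtractf diff_divide_distrib)

lemma emean_cmult: "emean x n (\<lambda>y. c * \<phi> y) = c * emean x n \<phi>"
  by (simp add: emean_def sum_distrib_left sum_divide_distrib)

lemma emean_const: "0 < n \<Longrightarrow> emean x n (\<lambda>y. c) = c"
  by (simp add: emean_def)

lemma emean_nonneg: "(\<And>y. 0 \<le> \<phi> y) \<Longrightarrow> 0 \<le> emean x n \<phi>"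
  by (auto simp: emean_def intro!: sum_nonneg divide_nonneg_nonneg)

lemma abs_emean_le:
  assumes "\<And>y. \<bar>\<phi> y\<bar> \<le> c" "0 \<le> c"
  shows "\<bar>emean x n \<phi>\<bar> \<le> c"
proof (cases "n = 0")
  case True then show ?thesis using assms by (simp add: emean_def)
next
  case False
  have "\<bar>\<Sum>j=1..n. \<phi> (x j)\<bar> \<le> (\<Sum>j=1..n. c)"
    using assms by (intro order_trans[OF sum_abs] sum_mono)
  then show ?thesis using False by (simp add: emean_def abs_mult field_simps)
qed

lemma inner_sample_mean: "inner f (sample_mean x n) = emean x n (inner f)"
  by (simp add: sample_mean_def emean_def inner_sum_right)

text \<open>The variance identity for the empirical measure. Its right-hand side averages only
  functions that are free of the sample mean.\<close>

lemma emean_centred_square: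
  assumes "0 < n"
  shows "emean x n (\<lambda>y. (inner f (y - sample_mean x n))\<^sup>2) = emean x n (\<lambda>y. (inner f y)\<^sup>2) - (emean x n (inner f))\<^sup>2"
proof -
  let ?u = "emean x n (inner f)"
  have "emean x n (\<lambda>y. (inner f (y - sample_mean x n))\<^sup>2)
      = emean x n (\<lambda>y. (inner f y)\<^sup>2 - 2 * ?u * inner f y + ?u\<^sup>2)"
    by (simp add: inner_diff_right inner_sample_mean power2_diff algebra_simps)
  also have "\<dots> = emean x n (\<lambda>y. (inner f y)\<^sup>2) - 2 * ?u * ?u + ?u\<^sup>2"
    using assms by (simp only: emean_add emean_diff emean_cmult emean_const)
  finally show ?thesis by (simp add: power2_eq_square)
qed

text \<open>
  The modulus in the statistic does not change when both characteristic functions are multiplied by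
  \<open>exp (- \<i> \<langle>f, sample_mean x n\<rangle>)\<close>, that is, when the sample is centred at its mean.
\<close>

definition dev :: "(nat \<Rightarrow> L2) \<Rightarrow> nat \<Rightarrow> L2 \<Rightarrow> real"
  where "dev x n f = emean x n (\<lambda>y. cas (inner f (y - sample_mean x n)))
    - exp (- emean x n (\<lambda>y. (inner f (y - sample_mean x n))\<^sup>2) / 2)"

lemma abs_dev_le: "\<bar>dev x n f\<bar> \<le> 3"
proof -
  have "\<bar>emean x n (\<lambda>y. cas (inner f (y - sample_mean x n)))\<bar> \<le> 2"
    by (intro abs_emean_le abs_cas_le) auto
  moreover have "exp (- emean x n (\<lambda>y. (inner f (y - sample_mean x n))\<^sup>2) / 2) \<le> 1"
    by (simp add: emean_nonneg)
  ultimately show ?thesis unfolding dev_def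
    by (smt (verit) exp_gt_zero)
qed

lemma sample_cov_inner:
  "inner (sample_cov x n f) f = emean x n (\<lambda>y. (inner f (y - sample_mean x n))\<^sup>2)"
  by (subst inner_commute) (simp add: sample_cov_eq(2) emean_def inner_sum_right power2_eq_square inner_commute)

lemma cmod_emp_cf_diff:
  "(cmod (empirical_cf x n f - gauss_cf (sample_mean x n) (sample_cov x n) f))\<^sup>2
    = (emean x n (\<lambda>y. cos (inner f (y - sample_mean x n))) - exp (- emean x n (\<lambda>y. (inner f (y - sample_mean x n))\<^sup>2) / 2))\<^sup>2
      + (emean x n (\<lambda>y. sin (inner f (y - sample_mean x n))))\<^sup>2" (is "_ = ?r")
proof -
  define m where "m = sample_mean x n"
  define v where "v = emean x n (\<lambda>y. (inner f (y - m))\<^sup>2)"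
  \<comment> \<open>\<open>c\<close> is the empirical characteristic function at \<open>f\<close> of
    the centred sample; the unimodular factor \<open>iexp (inner m f)\<close> is then common to both
    terms.\<close>
  define c where "c = Complex (emean x n (\<lambda>y. cos (inner f (y - m)))) (emean x n (\<lambda>y. sin (inner f (y - m))))"
  have c: "c = (1 / of_nat n) * (\<Sum>j=1..n. iexp (inner f (x j - m)))"
    by (simp add: c_def complex_eq_iff emean_def Re_exp Im_exp Re_divide_of_nat Im_divide_of_nat)
  have "empirical_cf x n f = iexp (inner m f) * c"
    unfolding empirical_cf_def c
    by (simp add: sum_distrib_left mult_exp_exp inner_diff_right inner_commute[of m] algebra_simps)
  moreover have "gauss_cf m (sample_cov x n) f = iexp (inner m f) * exp (- of_real (v / 2))"
    unfolding gauss_cf_def v_def m_def sample_cov_inner by (simp add: mult_exp_exp)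
  ultimately have "empirical_cf x n f - gauss_cf m (sample_cov x n) f
      = iexp (inner m f) * (c - of_real (exp (- v / 2)))"
    by (simp add: algebra_simps exp_of_real[symmetric])
  then have "(cmod (empirical_cf x n f - gauss_cf m (sample_cov x n) f))\<^sup>2 = (cmod (c - of_real (exp (- v / 2))))\<^sup>2"
    by (simp add: norm_mult)
  also have "\<dots> = (emean x n (\<lambda>y. cos (inner f (y - m))) - exp (- v / 2))\<^sup>2
      + (emean x n (\<lambda>y. sin (inner f (y - m))))\<^sup>2"
    unfolding cmod_power2 c_def by simp
  finally show ?thesis by (simp add: m_def v_def)
qed

text \<open>Here the sample mean enters only through a scalar empirical mean. The Taylor expansion
  and the joint measurability in \<open>f\<close> and the sample both start from this form.\<close>

lemma dev_alt:
  "0 < n \<Longrightarrow> dev x n f = emean x n (\<lambda>y. cas (inner f y - emean x n (inner f)))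
    - exp (- (emean x n (\<lambda>y. (inner f y)\<^sup>2) - (emean x n (inner f))\<^sup>2) / 2)"
  unfolding dev_def emean_centred_square by (simp add: inner_diff_right inner_sample_mean)

section \<open>Integration and limit theorems\<close>

lemma (in pair_sigma_finite) integrable_pair_dominated:
  fixes F :: "'a \<Rightarrow> 'b \<Rightarrow> real"
  assumes [measurable]: "case_prod F \<in> borel_measurable (M1 \<Otimes>\<^sub>M M2)"
    and a: "integrable M1 a" and b: "integrable M2 b"
    and bound: "\<And>x y. \<bar>F x y\<bar> \<le> a x * b y"
  shows "integrable (M1 \<Otimes>\<^sub>M M2) (case_prod F)"
proof (rule Bochner_Integration.integrable_bound)
  have [measurable]: "a \<in> borel_measurable M1" "b \<in> borel_measurable M2"
    using a b by auto
  show "integrable (M1 \<Otimes>\<^sub>M M2) (\<lambda>(x, y). a x * b y)"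
    using a b by (intro Fubini_integrable) (auto simp: abs_mult)
  show "AE p in M1 \<Otimes>\<^sub>M M2. norm (case_prod F p) \<le> norm (case p of (x, y) \<Rightarrow> a x * b y)"
    using order_trans[OF bound abs_ge_self] by (intro AE_I2) auto
qed simp

lemma integral_uminus_invariant:
  fixes F :: "'a::{real_normed_vector, second_countable_topology} \<Rightarrow> real"
  assumes sets: "sets Q = sets borel" and sym: "distr Q borel uminus = Q"
    and [measurable]: "F \<in> borel_measurable borel"
  shows "(LINT f|Q. F (- f)) = (LINT f|Q. F f)"
proof -
  have "uminus \<in> measurable Q borel"
    unfolding measurable_cong_sets[OF sets refl] by simp
  then have "(LINT f|distr Q borel uminus. F f) = (LINT f|Q. F (- f))"
    by (rule integral_distr) simp
  then show ?thesis by (simp add: sym)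
qed

text \<open>Used with \<open>h = Suc\<close> to turn a sample indexed from 1 into one indexed by all
  natural numbers.\<close>

lemma (in prob_space) indep_vars_reindex:
  assumes indep: "indep_vars M' X (h ` I)" and inj: "inj_on h I"
  shows "indep_vars (\<lambda>i. M' (h i)) (\<lambda>i. X (h i)) I"
  unfolding indep_vars_def2
proof (intro conjI ballI)
  fix i assume "i \<in> I" then show "random_variable (M' (h i)) (X (h i))"
    using indep unfolding indep_vars_def2 by auto
next
  define G where "G k = {X k -` A \<inter> space M |A. A \<in> sets (M' k)}" for k
  have G: "indep_sets G (h ` I)" using indep unfolding indep_vars_def2 G_def by simp
  have "indep_sets (\<lambda>i. G (h i)) I"
  proof (rule indep_setsI)
    show "G (h i) \<subseteq> events" if "i \<in> I" for i using G that by (auto simp: indep_sets_def)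
  next
    fix A J assume J: "J \<noteq> {}" "J \<subseteq> I" "finite J" "\<forall>j\<in>J. A j \<in> G (h j)"
    have injJ: "inj_on h J" using inj J(2) inj_on_subset by blast
    have inv: "the_inv_into J h (h j) = j" if "j \<in> J" for j
      using injJ that by (rule the_inv_into_f_f)
    \<comment> \<open>The events are carried to the image indices along the inverse of
      \<open>h\<close> on \<open>J\<close>; injectivity turns the product over the image back into
      one over \<open>J\<close>.\<close>
    have "prob (\<Inter>k\<in>h ` J. A (the_inv_into J h k)) = (\<Prod>k\<in>h ` J. prob (A (the_inv_into J h k)))"
      using J by (intro indep_setsD[OF G]) (auto simp: inv)
    then show "prob (\<Inter>j\<in>J. A j) = (\<Prod>j\<in>J. prob (A j))"
      by (simp add: prod.reindex[OF injJ] inv)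
  qed
  then show "indep_sets (\<lambda>i. {X (h i) -` A \<inter> space M |A. A \<in> sets (M' (h i))}) I"
    by (simp add: G_def)
qed

text \<open>Bienayme's identity by induction: the new summand is independent of the sum of the
  others, so the expectation of the cross term factors and vanishes. Integrability travels along in
  the same induction.\<close>

lemma (in prob_space) sum_indep_square:
  fixes Y :: "'i \<Rightarrow> 'a \<Rightarrow> real"
  assumes "finite J" "indep_vars (\<lambda>_. borel) Y J"
    and "\<And>j. j \<in> J \<Longrightarrow> integrable M (\<lambda>\<omega>. (Y j \<omega>)\<^sup>2)" "\<And>j. j \<in> J \<Longrightarrow> expectation (Y j) = 0"
  shows "integrable M (\<lambda>\<omega>. (\<Sum>j\<in>J. Y j \<omega>)\<^sup>2)
    \<and> expectation (\<lambda>\<omega>. (\<Sum>j\<in>J. Y j \<omega>)\<^sup>2) = (\<Sum>j\<in>J. expectation (\<lambda>\<omega>. (Y j \<omega>)\<^sup>2))"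
  using assms
proof (induction J rule: finite_induct)
  case empty
  then show ?case by simp
next
  case (insert i J)
  let ?S = "\<lambda>\<omega>. \<Sum>j\<in>J. Y j \<omega>"
  have meas: "random_variable borel (Y j)" if "j \<in> insert i J" for j
    using insert.prems(1) that unfolding indep_vars_def2 by auto
  note [measurable] = meas[OF insertI1]
  have int: "integrable M (Y j)" if "j \<in> insert i J" for j
    using meas[OF that] insert.prems(2)[OF that] by (rule square_integrable_imp_integrable)
  have IH: "integrable M (\<lambda>\<omega>. (?S \<omega>)\<^sup>2)" "expectation (\<lambda>\<omega>. (?S \<omega>)\<^sup>2) = (\<Sum>j\<in>J. expectation (\<lambda>\<omega>. (Y j \<omega>)\<^sup>2))"
    using insert.IH[OF indep_vars_subset[OF insert.prems(1)]] insert.prems(2,3) by auto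
  have intS: "integrable M ?S" using int by auto
  have ES: "expectation ?S = 0" using int insert.prems(3) by simp
  have ind: "indep_var borel (Y i) borel ?S"
    by (rule indep_vars_sum[OF insert.hyps insert.prems(1)])
  have cross: "integrable M (\<lambda>\<omega>. Y i \<omega> * ?S \<omega>)" "expectation (\<lambda>\<omega>. Y i \<omega> * ?S \<omega>) = 0"
    using indep_var_integrable[OF ind int intS] indep_var_lebesgue_integral[OF ind int intS] ES by auto
  have eq: "(\<Sum>j\<in>insert i J. Y j \<omega>)\<^sup>2 = (Y i \<omega>)\<^sup>2 + 2 * (Y i \<omega> * ?S \<omega>) + (?S \<omega>)\<^sup>2" for \<omega>
    using insert.hyps by (simp add: power2_sum)
  show ?case
    unfolding eq using insert.hyps insert.prems(2) cross IH by simp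
qed

section \<open>Characteristic functions and the real central limit theorem\<close>

lemma cmod_iexp_diff_le: "cmod (iexp a - iexp b) \<le> \<bar>a - b\<bar>"
proof -
  have "iexp a - iexp b = iexp b * (iexp (a - b) - 1)"
    by (simp add: algebra_simps mult_exp_exp)
  then show ?thesis using iexp_approx1[of "a - b" 0] by (simp add: norm_mult)
qed

text \<open>Takes the place of Slutsky's lemma: variables that are close in mean have close
  characteristic functions, because \<open>iexp\<close> is 1-Lipschitz.\<close>

lemma (in prob_space) char_distr_diff_le:
  assumes [measurable]: "random_variable borel Y" "random_variable borel Z"
    and int: "integrable M (\<lambda>\<omega>. Y \<omega> - Z \<omega>)"
  shows "cmod (char (distr M borel Y) t - char (distr M borel Z) t) \<le> \<bar>t\<bar> * expectation (\<lambda>\<omega>. \<bar>Y \<omega> - Z \<omega>\<bar>)"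
proof -
  have i: "integrable M (\<lambda>\<omega>. iexp (t * Y \<omega>))" if [measurable]: "random_variable borel Y" for Y
    by (rule integrable_const_bound[where B = 1]) auto
  have "char (distr M borel Y) t - char (distr M borel Z) t = (CLINT \<omega>|M. iexp (t * Y \<omega>) - iexp (t * Z \<omega>))"
    unfolding char_def by (simp add: integral_distr i del: of_real_mult)
  also have "cmod \<dots> \<le> expectation (\<lambda>\<omega>. cmod (iexp (t * Y \<omega>) - iexp (t * Z \<omega>)))"
    by (rule integral_norm_bound)
  also have "\<dots> \<le> expectation (\<lambda>\<omega>. \<bar>t\<bar> * \<bar>Y \<omega> - Z \<omega>\<bar>)"
  proof (rule integral_mono)
    show "cmod (iexp (t * Y \<omega>) - iexp (t * Z \<omega>)) \<le> \<bar>t\<bar> * \<bar>Y \<omega> - Z \<omega>\<bar>" for \<omega>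
      using cmod_iexp_diff_le[of "t * Y \<omega>" "t * Z \<omega>"]
      by (simp add: right_diff_distrib[symmetric] abs_mult del: of_real_mult)
  qed (use int i in \<open>auto intro!: integrable_norm Bochner_Integration.integrable_diff\<close>)
  finally show ?thesis by simp
qed

lemma char_scale:
  assumes [measurable_cong]: "sets N = sets borel"
  shows "char (distr N borel (\<lambda>x. c * x)) t = char N (c * t)"
  unfolding char_def by (subst integral_distr) (simp_all add: mult.assoc mult.left_commute)

lemma real_distribution_centred_normal: "real_distribution (centred_normal v)" if "0 \<le> v"
proof (cases "v = 0")
  case True
  then show ?thesis
    by (auto simp: centred_normal_def real_distribution_def real_distribution_axioms_def intro!: prob_space_return)
next
  case False
  then show ?thesis using that
    by (auto simp: centred_normal_def real_distribution_def real_distribution_axioms_def intro!: prob_space_normal_density)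
qed

text \<open>For \<open>v > 0\<close> the law is the standard normal law scaled by
  \<open>sqrt v\<close>; for the point mass at 0 both sides are 1.\<close>

lemma char_centred_normal:
  assumes "0 \<le> v"
  shows "char (centred_normal v) t = of_real (exp (- v * t\<^sup>2 / 2))"
proof (cases "v = 0")
  case True
  then show ?thesis by (simp add: centred_normal_def char_def integral_return)
next
  case False
  let ?s = "sqrt v"
  interpret N: prob_space std_normal_distribution by (rule prob_space_normal_density) simp
  have s: "0 < ?s" using False assms by simp
  have "distributed std_normal_distribution lborel (\<lambda>x. x) std_normal_density"
    by (auto simp: distributed_def distr_id2)
  from N.normal_density_affine[OF this, of ?s 0] s
  have "distr std_normal_distribution lborel (\<lambda>x. ?s * x) = density lborel (normal_density 0 ?s)"
    by (simp add: distributed_def)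
  moreover have "distr std_normal_distribution lborel (\<lambda>x. ?s * x) = distr std_normal_distribution borel (\<lambda>x. ?s * x)"
    by (rule distr_cong) auto
  ultimately have "centred_normal v = distr std_normal_distribution borel (\<lambda>x. ?s * x)"
    using False by (simp add: centred_normal_def)
  then show ?thesis
    using assms by (simp add: char_scale char_std_normal_distribution power_mult_distrib)
qed

text \<open>For positive variance this is the classical theorem read through characteristic
  functions. For variance 0 the summands vanish almost surely and every characteristic function in
  the sequence is 1.\<close>

lemma (in prob_space) iid_clt_char:
  fixes Y :: "nat \<Rightarrow> 'a \<Rightarrow> real"
  assumes indep: "indep_vars (\<lambda>_. borel) Y {1..}"
    and distr: "\<And>j. 1 \<le> j \<Longrightarrow> distr M borel (Y j) = distr M borel Z"
    and Z [measurable]: "random_variable borel Z"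
    and int: "integrable M (\<lambda>\<omega>. (Z \<omega>)\<^sup>2)" and mean: "expectation Z = 0"
  shows "(\<lambda>n. char (distr M borel (\<lambda>\<omega>. (\<Sum>j=1..n. Y j \<omega>) / sqrt n)) t)
    \<longlonglongrightarrow> char (centred_normal (expectation (\<lambda>\<omega>. (Z \<omega>)\<^sup>2))) t"
proof -
  define v where "v = expectation (\<lambda>\<omega>. (Z \<omega>)\<^sup>2)"
  have "0 \<le> v" unfolding v_def by simp
  have meas: "random_variable borel (Y j)" if "1 \<le> j" for j
    using indep that unfolding indep_vars_def2 by auto
  have eq: "expectation (\<lambda>\<omega>. g (Y j \<omega>)) = expectation (\<lambda>\<omega>. g (Z \<omega>))"
    "integrable M (\<lambda>\<omega>. g (Y j \<omega>)) \<longleftrightarrow> integrable M (\<lambda>\<omega>. g (Z \<omega>))"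
    if [measurable]: "g \<in> borel_measurable borel" and "1 \<le> j" for j and g :: "real \<Rightarrow> real"
  proof -
    note [measurable] = meas[OF that(2)]
    show "expectation (\<lambda>\<omega>. g (Y j \<omega>)) = expectation (\<lambda>\<omega>. g (Z \<omega>))"
      using arg_cong[OF distr[OF that(2)], of "\<lambda>N. integral\<^sup>L N g"] by (simp add: integral_distr)
    show "integrable M (\<lambda>\<omega>. g (Y j \<omega>)) \<longleftrightarrow> integrable M (\<lambda>\<omega>. g (Z \<omega>))"
      using arg_cong[OF distr[OF that(2)], of "\<lambda>N. integrable N g"] by (simp add: integrable_distr_eq)
  qed
  define S where "S n \<omega> = (\<Sum>j=1..n. Y j \<omega>)" for n \<omega>
  have sum: "(\<Sum>i<n. Y (Suc i) \<omega>) = S n \<omega>" for n \<omega>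
    by (simp add: S_def sum.atLeast1_atMost_eq)
  have S: "random_variable borel (S n)" for n
    unfolding S_def[abs_def] using meas by (intro borel_measurable_sum) auto
  have "(\<lambda>n. char (distr M borel (\<lambda>\<omega>. S n \<omega> / sqrt n)) t) \<longlonglongrightarrow> char (centred_normal v) t"
  proof (cases "v = 0")
    case True
    have "AE \<omega> in M. Y j \<omega> = 0" if "1 \<le> j" for j
    proof -
      note [measurable] = meas[OF that]
      have "expectation (\<lambda>\<omega>. (Y j \<omega>)\<^sup>2) = 0" "integrable M (\<lambda>\<omega>. (Y j \<omega>)\<^sup>2)"
        using eq[OF _ that, of "\<lambda>x. x\<^sup>2"] int True by (auto simp: v_def)
      then have "AE \<omega> in M. (Y j \<omega>)\<^sup>2 = 0" by (subst (asm) integral_nonneg_eq_0_iff_AE) auto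
      then show ?thesis by simp
    qed
    then have ae: "AE \<omega> in M. \<forall>j\<in>{1..}. Y j \<omega> = 0" by (intro AE_ball_countable') auto
    have "char (distr M borel (\<lambda>\<omega>. S n \<omega> / sqrt n)) t = 1" for n
    proof -
      note [measurable] = S[of n]
      have "AE \<omega> in M. S n \<omega> = 0" using ae by eventually_elim (simp add: S_def)
      then have "(CLINT \<omega>|M. iexp (t * (S n \<omega> / sqrt n))) = (CLINT \<omega>|M. 1)"
        by (intro integral_cong_AE) (auto elim!: eventually_mono)
      then show ?thesis by (simp add: char_def integral_distr prob_space)
    qed
    then show ?thesis using True by (simp add: char_centred_normal)
  next
    case False
    then have "0 < v" using \<open>0 \<le> v\<close> by simp
    have "indep_vars (\<lambda>_. borel) (\<lambda>i. Y (Suc i)) UNIV"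
    proof (rule indep_vars_reindex)
      have "range Suc = {1..}" by (auto simp: image_iff Suc_le_eq gr0_conv_Suc)
      then show "indep_vars (\<lambda>_. borel) Y (range Suc)" using indep by simp
    qed simp
    from central_limit_theorem_zero_mean[OF this, of "sqrt v" "distr M borel Z", unfolded sum]
    have "weak_conv_m (\<lambda>n. distr M borel (\<lambda>\<omega>. S n \<omega> / sqrt (n * (sqrt v)\<^sup>2))) std_normal_distribution"
      using eq[of "\<lambda>x. x" "Suc _"] eq[of "\<lambda>x. x\<^sup>2" "Suc _"] mean int \<open>0 < v\<close> distr[of "Suc _"]
      by (simp add: v_def)
    \<comment> \<open>The classical theorem also divides by the standard deviation; evaluation at
      \<open>sqrt v * t\<close> undoes this.\<close>
    then have "(\<lambda>n. char (distr M borel (\<lambda>\<omega>. S n \<omega> / sqrt (n * (sqrt v)\<^sup>2))) (sqrt v * t))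
        \<longlonglongrightarrow> char std_normal_distribution (sqrt v * t)"
      using S by (intro levy_continuity1 real_distribution_distr real_dist_normal_dist) auto
    moreover have "char (distr M borel (\<lambda>\<omega>. S n \<omega> / sqrt (n * (sqrt v)\<^sup>2))) (sqrt v * t)
        = char (distr M borel (\<lambda>\<omega>. S n \<omega> / sqrt n)) t" for n
    proof -
      note [measurable] = S[of n]
      show ?thesis using \<open>0 < v\<close> by (simp add: char_def integral_distr real_sqrt_mult)
    qed
    ultimately show ?thesis
      using \<open>0 < v\<close> by (simp add: char_centred_normal char_std_normal_distribution power_mult_distrib)
  qed
  then show ?thesis by (simp only: S_def v_def)
qed

section \<open>Linearization of the statistic\<close>

text \<open>Built on the product of weight and sample space, since Fubini's theorem is applied
  between the two. In qualified names \<open>M1\<close> stands for \<open>Q\<close> and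
  \<open>M2\<close> for \<open>M\<close>.\<close>

locale weighted_sample = pair_prob_space Q M
  for Q :: "L2 measure" and M :: "'w measure" +
  fixes X :: "'w \<Rightarrow> L2" and Xs :: "nat \<Rightarrow> 'w \<Rightarrow> L2"
  assumes sets_Q [measurable_cong]: "sets Q = sets borel"
    and Q_symmetric: "distr Q borel uminus = Q"
    and Q_moment: "integrable Q (\<lambda>f. norm f ^ 4)"
    and X_measurable [measurable]: "X \<in> borel_measurable M"
    and X_moment: "integrable M (\<lambda>\<omega>. norm (X \<omega>) ^ 4)"
    and X_centred: "(LINT \<omega>|M. X \<omega>) = 0"
    and Xs_indep: "M2.indep_vars (\<lambda>_. borel) Xs {1..}"
    and Xs_distr: "\<And>j. j \<ge> 1 \<Longrightarrow> distr M borel (Xs j) = distr M borel X"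
begin

section \<open>Moments and population quantities\<close>

lemma Xs_measurable: "1 \<le> j \<Longrightarrow> Xs j \<in> borel_measurable M"
  using Xs_indep unfolding M2.indep_vars_def2 by auto

lemma X_moment2: "integrable M (\<lambda>\<omega>. (norm (X \<omega>))\<^sup>2)"
proof (rule Bochner_Integration.integrable_bound)
  show "integrable M (\<lambda>\<omega>. 1 + norm (X \<omega>) ^ 4)" using X_moment by simp
qed (use square_le_one_plus_fourth in auto)

lemma Q_moment2: "integrable Q (\<lambda>f. (norm f)\<^sup>2)"
proof (rule Bochner_Integration.integrable_bound)
  show "integrable Q (\<lambda>f. 1 + norm f ^ 4)" using Q_moment by simp
qed (use square_le_one_plus_fourth in auto)

lemma integrable_cas: "integrable M (\<lambda>\<omega>. cas (g (X \<omega>)))" if [measurable]: "g \<in> borel_measurable borel"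
  by (rule M2.integrable_const_bound[where B = 2]) (auto intro: abs_cas_le)

lemma integrable_inner_square: "integrable M (\<lambda>\<omega>. (inner f (X \<omega>))\<^sup>2)"
proof (rule Bochner_Integration.integrable_bound)
  show "integrable M (\<lambda>\<omega>. (norm f)\<^sup>2 * (norm (X \<omega>))\<^sup>2)" using X_moment2 by simp
qed (use inner_square_le in auto)

lemma integrable_inner: "integrable M (\<lambda>\<omega>. inner f (X \<omega>))"
  by (rule M2.square_integrable_imp_integrable[OF _ integrable_inner_square]) simp

lemma integrable_inner_fourth: "integrable M (\<lambda>\<omega>. ((inner f (X \<omega>))\<^sup>2)\<^sup>2)"
proof (rule Bochner_Integration.integrable_bound)
  show "integrable M (\<lambda>\<omega>. norm f ^ 4 * norm (X \<omega>) ^ 4)" using X_moment by simp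
qed (use inner_fourth_le in auto)

lemma integrable_X: "integrable M X"
proof (rule Bochner_Integration.integrable_bound)
  show "integrable M (\<lambda>\<omega>. 1 + (norm (X \<omega>))\<^sup>2)" using X_moment2 by simp
  have "r \<le> 1 + r\<^sup>2" for r :: real
    using zero_le_power2[of "r - 1 / 2"] by (simp add: power2_diff power_divide)
  then show "AE \<omega> in M. norm (X \<omega>) \<le> norm (1 + (norm (X \<omega>))\<^sup>2)" by simp
qed simp

lemma mean_inner: "(LINT \<omega>|M. inner f (X \<omega>)) = 0"
  using integral_inner_right[OF integrable_X, of f] by (simp add: X_centred)

text \<open>\<open>cas_mean\<close> is the real plus the imaginary part of the characteristic
  functional, \<open>cas_refl_mean\<close> is the mean derivative of \<open>cas\<close> at
  \<open>inner f (X \<omega>)\<close>, and \<open>second_moment\<close> is the variance in direction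
  \<open>f\<close>, as \<open>X\<close> is centred.\<close>

definition cas_mean :: "L2 \<Rightarrow> real" where "cas_mean f = (LINT \<omega>|M. cas (inner f (X \<omega>)))"
definition cas_refl_mean :: "L2 \<Rightarrow> real" where "cas_refl_mean f = (LINT \<omega>|M. cas (- inner f (X \<omega>)))"
definition second_moment :: "L2 \<Rightarrow> real" where "second_moment f = (LINT \<omega>|M. (inner f (X \<omega>))\<^sup>2)"

lemma cas_mean_measurable [measurable]: "cas_mean \<in> borel_measurable borel"
  unfolding cas_mean_def[abs_def] by measurable

lemma cas_refl_mean_measurable [measurable]: "cas_refl_mean \<in> borel_measurable borel"
  unfolding cas_refl_mean_def[abs_def] by measurable

lemma second_moment_measurable [measurable]: "second_moment \<in> borel_measurable borel"
  unfolding second_moment_def[abs_def] by measurable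

lemma second_moment_nonneg: "0 \<le> second_moment f"
  by (simp add: second_moment_def)

lemma second_moment_le: "second_moment f \<le> (norm f)\<^sup>2 * (LINT \<omega>|M. (norm (X \<omega>))\<^sup>2)"
  unfolding second_moment_def integral_mult_right_zero[symmetric]
  by (intro integral_mono integrable_inner_square inner_square_le integrable_mult_right X_moment2)

lemma abs_cas_mean_le: "\<bar>cas_mean f\<bar> \<le> 2"
proof -
  have "\<bar>cas_mean f\<bar> \<le> (LINT \<omega>|M. \<bar>cas (inner f (X \<omega>))\<bar>)"
    unfolding cas_mean_def by (rule integral_abs_bound)
  also have "\<dots> \<le> (LINT \<omega>|M. 2)"
    by (intro integral_mono abs_cas_le integrable_abs integrable_cas) auto
  finally show ?thesis by (simp add: M2.prob_space)
qed

lemma abs_cas_refl_mean_le: "\<bar>cas_refl_mean f\<bar> \<le> 2"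
  using abs_cas_mean_le[of "- f"] by (simp add: cas_mean_def cas_refl_mean_def)

lemma sigma2_eq: "sigma2 M X f = second_moment f"
proof -
  \<comment> \<open>Integrability in the Hilbert space lets the inner product with \<open>f\<close>
    pass under the Bochner integral that defines the covariance operator.\<close>
  have "integrable M (\<lambda>\<omega>. inner (X \<omega>) f *\<^sub>R X \<omega>)"
  proof (rule Bochner_Integration.integrable_bound)
    show "integrable M (\<lambda>\<omega>. norm f * (norm (X \<omega>))\<^sup>2)" using X_moment2 by simp
    have "\<bar>inner x f\<bar> * norm x \<le> norm f * (norm x)\<^sup>2" for x
      using mult_right_mono[OF Cauchy_Schwarz_ineq2[of x f] norm_ge_zero[of x]]
      by (simp add: power2_eq_square ac_simps)
    then show "AE \<omega> in M. norm (inner (X \<omega>) f *\<^sub>R X \<omega>) \<le> norm (norm f * (norm (X \<omega>))\<^sup>2)"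
      by simp
  qed simp
  from integral_inner_left[OF this, of f] show ?thesis
    by (simp add: sigma2_def cov_op_def X_centred second_moment_def power2_eq_square inner_commute)
qed

lemma integrable_trig:
  fixes g :: "L2 \<Rightarrow> real"
  assumes [measurable]: "g \<in> borel_measurable borel"
  shows "integrable M (\<lambda>\<omega>. cos (g (X \<omega>)))" "integrable M (\<lambda>\<omega>. sin (g (X \<omega>)))"
proof -
  show "integrable M (\<lambda>\<omega>. cos (g (X \<omega>)))" by (rule M2.integrable_const_bound[where B = 1]) auto
  show "integrable M (\<lambda>\<omega>. sin (g (X \<omega>)))" by (rule M2.integrable_const_bound[where B = 1]) auto
qed

lemma z_fun_eq: "z_fun M X f = cas_mean f - exp (- second_moment f / 2)"
  unfolding z_fun_def sigma2_eq cas_mean_def cas_def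
  by (subst Bochner_Integration.integral_add) (simp_all add: integrable_trig)

lemma z_fun_measurable [measurable]: "z_fun M X \<in> borel_measurable borel"
  unfolding z_fun_eq[abs_def] by measurable

lemma abs_z_fun_le: "\<bar>z_fun M X f\<bar> \<le> 3"
proof -
  have "exp (- second_moment f / 2) \<le> 1" using second_moment_nonneg[of f] by simp
  then show ?thesis
    using abs_cas_mean_le[of f] exp_gt_zero[of "- second_moment f / 2"] unfolding z_fun_eq by linarith
qed

text \<open>In this form \<open>xi\<close> is the first-order influence of an observation on
  \<open>dev\<close>: the error of the \<open>cas\<close> average, the effect of centring, weighted
  by the mean derivative of \<open>cas\<close>, and the effect of the second moment on the Gaussian
  term.\<close>

lemma xi_eq:
  "xi M X f x = cas (inner f x) - cas_mean f - inner f x * cas_refl_mean f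
    + 1 / 2 * exp (- second_moment f / 2) * ((inner f x)\<^sup>2 - second_moment f)"
proof -
  have "cas_mean f = (LINT \<omega>|M. cos (inner f (X \<omega>))) + (LINT \<omega>|M. sin (inner f (X \<omega>)))"
    unfolding cas_mean_def cas_def by (intro Bochner_Integration.integral_add integrable_trig) auto
  moreover have "(LINT \<omega>|M. sin (inner f (X \<omega>)) - cos (inner f (X \<omega>))) = - cas_refl_mean f"
    unfolding cas_refl_mean_def integral_minus[symmetric]
    by (rule Bochner_Integration.integral_cong) (simp_all add: cas_def)
  ultimately show ?thesis unfolding xi_def sigma2_eq by (simp add: cas_def)
qed

lemma xi_measurable [measurable (raw)]:
  assumes [measurable]: "F \<in> borel_measurable N" "G \<in> borel_measurable N"
  shows "(\<lambda>w. xi M X (F w) (G w)) \<in> borel_measurable N"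
  unfolding xi_eq by measurable

section \<open>Reduction of the statistic and of its limit to integrals of real squares\<close>

lemma integrable_Q_bounded:
  fixes h :: "L2 \<Rightarrow> real"
  shows "h \<in> borel_measurable borel \<Longrightarrow> (\<And>f. \<bar>h f\<bar> \<le> c) \<Longrightarrow> integrable Q h"
  by (rule M1.integrable_const_bound[where B = c]) (auto simp: measurable_cong_sets[OF sets_Q refl])

text \<open>By symmetry of \<open>Q\<close>, the product of an even and an odd function integrates to zero.\<close>

lemma integral_even_odd_squares:
  assumes a [measurable]: "a \<in> borel_measurable borel" and b [measurable]: "b \<in> borel_measurable borel"
    and bd: "\<And>f. \<bar>a f\<bar> \<le> A" "\<And>f. \<bar>b f\<bar> \<le> B"
    and even: "\<And>f. a (- f) = a f" and odd: "\<And>f. b (- f) = - b f"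
  shows "(LINT f|Q. (a f)\<^sup>2 + (b f)\<^sup>2) = (LINT f|Q. (a f + b f :: real)\<^sup>2)"
proof -
  have "0 \<le> A" using bd(1)[of 0] by linarith
  have bsq: "\<bar>(u::real)\<^sup>2\<bar> \<le> c\<^sup>2" if "\<bar>u\<bar> \<le> c" for u c
    using that by (simp add: abs_le_square_iff[symmetric])
  have "integrable Q (\<lambda>f. (a f)\<^sup>2)" "integrable Q (\<lambda>f. (b f)\<^sup>2)"
    using bsq[OF bd(1)] bsq[OF bd(2)] by (auto intro!: integrable_Q_bounded)
  moreover have "\<bar>a f * b f\<bar> \<le> A * B" for f
    unfolding abs_mult using bd \<open>0 \<le> A\<close> by (intro mult_mono) auto
  then have "integrable Q (\<lambda>f. a f * b f)" by (intro integrable_Q_bounded) auto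
  moreover have "(LINT f|Q. a f * b f) = 0"
    using integral_uminus_invariant[OF sets_Q Q_symmetric, of "\<lambda>f. a f * b f"]
    by (simp add: even odd)
  ultimately show ?thesis by (simp add: power2_sum mult.assoc)
qed

lemma T_stat_eq: "T_stat Q x n = (LINT f|Q. (dev x n f)\<^sup>2)"
proof -
  let ?m = "sample_mean x n"
  \<comment> \<open>\<open>a\<close> and \<open>b\<close> are the real and imaginary parts of the
    difference for the centred sample, even and odd in \<open>f\<close>. Their sum is
    \<open>dev\<close>.\<close>
  define a where "a f = emean x n (\<lambda>y. cos (inner f (y - ?m))) - exp (- emean x n (\<lambda>y. (inner f (y - ?m))\<^sup>2) / 2)" for f
  define b where "b f = emean x n (\<lambda>y. sin (inner f (y - ?m)))" for f
  have [measurable]: "a \<in> borel_measurable borel" "b \<in> borel_measurable borel"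
    unfolding a_def[abs_def] b_def[abs_def] emean_def by measurable
  have "\<bar>a f\<bar> \<le> 2" for f
  proof -
    have "\<bar>emean x n (\<lambda>y. cos (inner f (y - ?m)))\<bar> \<le> 1" by (rule abs_emean_le) auto
    moreover have "exp (- emean x n (\<lambda>y. (inner f (y - ?m))\<^sup>2) / 2) \<le> 1" by (simp add: emean_nonneg)
    ultimately show ?thesis
      using exp_gt_zero[of "- emean x n (\<lambda>y. (inner f (y - ?m))\<^sup>2) / 2"] unfolding a_def by linarith
  qed
  moreover have "\<bar>b f\<bar> \<le> 1" for f unfolding b_def by (rule abs_emean_le) auto
  moreover have "a (- f) = a f" "b (- f) = - b f" for f
    by (simp_all add: a_def b_def emean_def sum_negf)
  ultimately have "(LINT f|Q. (a f)\<^sup>2 + (b f)\<^sup>2) = (LINT f|Q. (a f + b f)\<^sup>2)"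
    by (intro integral_even_odd_squares) auto
  moreover have "a f + b f = dev x n f" for f
    by (simp add: a_def b_def dev_def cas_def emean_add)
  ultimately show ?thesis
    unfolding T_stat_def cmod_emp_cf_diff a_def b_def by simp
qed

lemma tau_eq: "tau Q M X = (LINT f|Q. (z_fun M X f)\<^sup>2)"
proof -
  \<comment> \<open>The same split for the population. The Gaussian term is real because the mean is
    0, so it enters \<open>a\<close> only.\<close>
  define a where "a f = (LINT \<omega>|M. cos (inner f (X \<omega>))) - exp (- second_moment f / 2)" for f
  define b where "b f = (LINT \<omega>|M. sin (inner f (X \<omega>)))" for f
  have [measurable]: "a \<in> borel_measurable borel" "b \<in> borel_measurable borel"
    unfolding a_def[abs_def] b_def[abs_def] by measurable
  have le: "\<bar>LINT \<omega>|M. h (X \<omega>)\<bar> \<le> 1" if [measurable]: "h \<in> borel_measurable borel" and "\<And>x. \<bar>h x\<bar> \<le> 1" for h :: "L2 \<Rightarrow> real"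
  proof -
    have "\<bar>LINT \<omega>|M. h (X \<omega>)\<bar> \<le> (LINT \<omega>|M. \<bar>h (X \<omega>)\<bar>)" by (rule integral_abs_bound)
    also have "\<dots> \<le> (LINT \<omega>|M. 1)"
      using that(2) by (intro integral_mono integrable_abs M2.integrable_const_bound[where B = 1]) auto
    finally show ?thesis by (simp add: M2.prob_space)
  qed
  have "\<bar>a f\<bar> \<le> 2" for f
  proof -
    have "exp (- second_moment f / 2) \<le> 1" using second_moment_nonneg[of f] by simp
    moreover have "\<bar>LINT \<omega>|M. cos (inner f (X \<omega>))\<bar> \<le> 1" by (rule le) auto
    ultimately show ?thesis
      using exp_gt_zero[of "- second_moment f / 2"] unfolding a_def by linarith
  qed
  moreover have "\<bar>b f\<bar> \<le> 1" for f unfolding b_def by (rule le) auto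
  moreover have "a (- f) = a f" "b (- f) = - b f" for f
    by (simp_all add: a_def b_def second_moment_def)
  ultimately have "(LINT f|Q. (a f)\<^sup>2 + (b f)\<^sup>2) = (LINT f|Q. (a f + b f)\<^sup>2)"
    by (intro integral_even_odd_squares) auto
  moreover have "a f + b f = z_fun M X f" for f
    by (simp add: a_def b_def z_fun_def sigma2_eq)
  moreover have "(cmod (char_functional M X f - gauss_cf 0 (cov_op M X) f))\<^sup>2 = (a f)\<^sup>2 + (b f)\<^sup>2" for f
  proof -
    have "integrable M (\<lambda>\<omega>. iexp (inner (X \<omega>) f))"
      by (rule M2.integrable_const_bound[where B = 1]) auto
    from integral_Re[OF this] integral_Im[OF this]
    have "char_functional M X f = Complex (LINT \<omega>|M. cos (inner f (X \<omega>))) (b f)"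
      by (simp add: complex_eq_iff char_functional_def b_def Re_exp Im_exp inner_commute)
    moreover have "gauss_cf 0 (cov_op M X) f = of_real (exp (- second_moment f / 2))"
      unfolding gauss_cf_def by (simp add: sigma2_eq[unfolded sigma2_def] exp_of_real[symmetric])
    ultimately show ?thesis by (simp add: a_def cmod_power2)
  qed
  ultimately show ?thesis unfolding tau_def X_centred by simp
qed

section \<open>Pathwise expansion of \<open>dev\<close>\<close>

text \<open>The squared errors of the four empirical means that govern the expansion; the population
  value of the second one is 0.\<close>

definition square_error :: "(nat \<Rightarrow> L2) \<Rightarrow> nat \<Rightarrow> L2 \<Rightarrow> real"
  where "square_error x n f =
    (emean x n (\<lambda>y. cas (inner f y)) - cas_mean f)\<^sup>2 + (emean x n (inner f))\<^sup>2
    + (emean x n (\<lambda>y. (inner f y)\<^sup>2) - second_moment f)\<^sup>2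
    + (emean x n (\<lambda>y. cas (- inner f y)) - cas_refl_mean f)\<^sup>2"

lemma square_error_nonneg: "0 \<le> square_error x n f"
  unfolding square_error_def by simp

text \<open>For a fixed sample, \<open>dev\<close> is expanded in empirical means around their
  population values. The first bound collects second-order remainders; the second one combines
  Lipschitz estimates with boundedness of the exponential.\<close>

lemma
  assumes n: "0 < n"
  shows dev_first_order: "\<bar>dev x n f - z_fun M X f - emean x n (xi M X f)\<bar> \<le> 3 * square_error x n f"
    and dev_zeroth_order: "(dev x n f - z_fun M X f)\<^sup>2 \<le> 27 * square_error x n f"
proof -
  define u where "u = emean x n (inner f)"
  define S where "S = emean x n (\<lambda>y. (inner f y)\<^sup>2)"
  define H where "H = emean x n (\<lambda>y. cas (inner f y)) - cas_mean f"
  define G where "G = emean x n (\<lambda>y. cas (- inner f y)) - cas_refl_mean f"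
  define s where "s = second_moment f"
  define c where "c = emean x n (\<lambda>y. cas (inner f y - u)) - emean x n (\<lambda>y. cas (inner f y))"
  \<comment> \<open>\<open>S - u\<^sup>2\<close> is an empirical variance, so the estimates for
    \<open>exp (- t / 2)\<close> with \<open>t \<ge> 0\<close> apply to all exponents below.\<close>
  have nonneg: "0 \<le> S - u\<^sup>2" "0 \<le> S" "0 \<le> s"
    using emean_centred_square[OF n, of x f] emean_nonneg[of "\<lambda>y. (inner f (y - sample_mean x n))\<^sup>2" x n]
    by (auto simp: S_def u_def s_def emean_nonneg second_moment_nonneg)
  have dev: "dev x n f = c + emean x n (\<lambda>y. cas (inner f y)) - exp (- (S - u\<^sup>2) / 2)"
    using dev_alt[OF n] by (simp add: c_def S_def u_def)
  have diff: "dev x n f - z_fun M X f = H + c - (exp (- (S - u\<^sup>2) / 2) - exp (- s / 2))"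
    unfolding dev z_fun_eq H_def s_def by simp
  have B: "square_error x n f = H\<^sup>2 + u\<^sup>2 + (S - s)\<^sup>2 + G\<^sup>2"
    by (simp add: square_error_def H_def u_def S_def s_def G_def)
  have e1: "\<bar>exp (- (S - u\<^sup>2) / 2) - exp (- S / 2)\<bar> \<le> u\<^sup>2 / 2"
    using exp_half_lipschitz[OF nonneg(1,2)] by simp
  have xi: "emean x n (xi M X f) = H - u * cas_refl_mean f + 1 / 2 * exp (- s / 2) * (S - s)"
    unfolding xi_eq[abs_def] H_def u_def S_def s_def
    by (simp only: emean_add emean_diff emean_cmult emean_const[OF n] mult.commute[of "inner f _"] mult.commute[of "emean _ _ (inner f)"])
  have t1: "\<bar>c + u * emean x n (\<lambda>y. cas (- inner f y))\<bar> \<le> 2 * u\<^sup>2"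
  proof -
    have "c + u * emean x n (\<lambda>y. cas (- inner f y))
        = emean x n (\<lambda>y. cas (inner f y - u) - cas (inner f y) + u * cas (- inner f y))"
      unfolding c_def by (simp only: emean_add emean_diff emean_cmult)
    also have "\<bar>\<dots>\<bar> \<le> 2 * u\<^sup>2" by (rule abs_emean_le[OF cas_taylor]) simp
    finally show ?thesis .
  qed
  have t2: "\<bar>exp (- S / 2) - exp (- s / 2) + 1 / 2 * exp (- s / 2) * (S - s)\<bar> \<le> (S - s)\<^sup>2 / 4"
    by (rule exp_half_taylor[OF nonneg(2,3)])
  have t3: "\<bar>u * G\<bar> \<le> u\<^sup>2 / 2 + G\<^sup>2 / 2"
    using sum_squares_bound[of "\<bar>u\<bar>" "\<bar>G\<bar>"] by (simp add: abs_mult)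
  \<comment> \<open>Four sources of error: the Taylor remainder of \<open>cas\<close>, the
    replacement of the empirical mean derivative by its population value (\<open>u * G\<close>), the
    term \<open>u\<^sup>2\<close> in the empirical variance, and the Taylor remainder of the
    exponential.\<close>
  have "dev x n f - z_fun M X f - emean x n (xi M X f)
      = (c + u * emean x n (\<lambda>y. cas (- inner f y))) - u * G - (exp (- (S - u\<^sup>2) / 2) - exp (- S / 2))
        - (exp (- S / 2) - exp (- s / 2) + 1 / 2 * exp (- s / 2) * (S - s))"
    unfolding diff xi G_def by (simp add: algebra_simps)
  moreover have "\<bar>p - q - r - t\<bar> \<le> \<bar>p\<bar> + \<bar>q\<bar> + \<bar>r\<bar> + \<bar>t\<bar>" for p q r t :: real by linarith
  ultimately have "\<bar>dev x n f - z_fun M X f - emean x n (xi M X f)\<bar>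
      \<le> \<bar>c + u * emean x n (\<lambda>y. cas (- inner f y))\<bar> + \<bar>u * G\<bar> + \<bar>exp (- (S - u\<^sup>2) / 2) - exp (- S / 2)\<bar>
        + \<bar>exp (- S / 2) - exp (- s / 2) + 1 / 2 * exp (- s / 2) * (S - s)\<bar>" by metis
  also have "\<dots> \<le> 2 * u\<^sup>2 + (u\<^sup>2 / 2 + G\<^sup>2 / 2) + u\<^sup>2 / 2 + (S - s)\<^sup>2 / 4"
    by (intro add_mono t1 t2 t3 e1)
  also have "\<dots> \<le> 3 * square_error x n f"
  proof -
    \<comment> \<open>The coefficients of \<open>p\<close> on the left add up to exactly 3, which
      fixes the constant.\<close>
    have arith: "2 * p + (p / 2 + q / 2) + p / 2 + r / 4 \<le> 3 * (h + p + r + q)"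
      if "0 \<le> h" "0 \<le> q" "0 \<le> r" for h p q r :: real using that by simp
    show ?thesis unfolding B by (rule arith) simp_all
  qed
  finally show "\<bar>dev x n f - z_fun M X f - emean x n (xi M X f)\<bar> \<le> 3 * square_error x n f" .
  have c: "\<bar>c\<bar> \<le> 2 * \<bar>u\<bar>"
  proof -
    have "c = emean x n (\<lambda>y. cas (inner f y - u) - cas (inner f y))" unfolding c_def emean_diff ..
    also have "\<bar>\<dots>\<bar> \<le> 2 * \<bar>u\<bar>"
    proof (rule abs_emean_le)
      show "\<bar>cas (inner f y - u) - cas (inner f y)\<bar> \<le> 2 * \<bar>u\<bar>" for y
        using cas_lipschitz[of "inner f y - u" "inner f y"] by simp
    qed simp
    finally show ?thesis .
  qed
  have e2: "\<bar>exp (- (S - u\<^sup>2) / 2) - exp (- S / 2)\<bar> \<le> \<bar>u\<bar>"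
  \<comment> \<open>The quadratic bound \<open>e1\<close> is linear in \<open>\<bar>u\<bar>\<close>
    only for small \<open>u\<close>; for large \<open>u\<close> it is enough that both exponentials
    lie between 0 and 1.\<close>
  proof (cases "\<bar>u\<bar> \<le> 1")
    case True
    then have "u\<^sup>2 \<le> \<bar>u\<bar>" using mult_left_mono[OF True, of "\<bar>u\<bar>"] by (simp add: power2_eq_square)
    then show ?thesis using e1 by linarith
  next
    case False
    have "exp (- (S - u\<^sup>2) / 2) \<le> 1" "exp (- S / 2) \<le> 1" using nonneg by auto
    then show ?thesis using False exp_gt_zero[of "- (S - u\<^sup>2) / 2"] exp_gt_zero[of "- S / 2"] by linarith
  qed
  have e3: "\<bar>exp (- S / 2) - exp (- s / 2)\<bar> \<le> \<bar>S - s\<bar>"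
    by (rule order_trans[OF exp_half_lipschitz[OF nonneg(2,3)]]) simp
  have "\<bar>dev x n f - z_fun M X f\<bar> \<le> \<bar>H\<bar> + 3 * \<bar>u\<bar> + \<bar>S - s\<bar>"
  proof -
    have "\<bar>h + d - (p - r)\<bar> \<le> \<bar>h\<bar> + \<bar>d\<bar> + (\<bar>p - q\<bar> + \<bar>q - r\<bar>)" for h d p q r :: real by linarith
    then have "\<bar>dev x n f - z_fun M X f\<bar>
        \<le> \<bar>H\<bar> + \<bar>c\<bar> + (\<bar>exp (- (S - u\<^sup>2) / 2) - exp (- S / 2)\<bar> + \<bar>exp (- S / 2) - exp (- s / 2)\<bar>)"
      unfolding diff .
    also have "\<dots> \<le> \<bar>H\<bar> + 2 * \<bar>u\<bar> + (\<bar>u\<bar> + \<bar>S - s\<bar>)"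
      by (intro add_mono order_refl c e2 e3)
    finally show ?thesis by simp
  qed
  then have "(dev x n f - z_fun M X f)\<^sup>2 \<le> (\<bar>H\<bar> + 3 * \<bar>u\<bar> + \<bar>S - s\<bar>)\<^sup>2"
    by (metis abs_ge_zero power2_abs power_mono)
  \<comment> \<open>The square of \<open>3 * \<bar>u\<bar>\<close> has the largest weight, hence 27
    as 3 times 9.\<close>
  also have "\<dots> \<le> 3 * (\<bar>H\<bar>\<^sup>2 + (3 * \<bar>u\<bar>)\<^sup>2 + \<bar>S - s\<bar>\<^sup>2)"
  proof -
    have "(a + b + d)\<^sup>2 \<le> 3 * (a\<^sup>2 + b\<^sup>2 + d\<^sup>2)" for a b d :: real
      using sum_squares_bound[of a b] sum_squares_bound[of a d] sum_squares_bound[of b d]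
      by (simp add: power2_eq_square algebra_simps)
    then show ?thesis .
  qed
  also have "\<dots> \<le> 27 * square_error x n f"
    unfolding B by (simp add: power_mult_distrib)
  finally show "(dev x n f - z_fun M X f)\<^sup>2 \<le> 27 * square_error x n f" .
qed

section \<open>Mean square errors of the empirical means\<close>

lemma sample_integral:
  fixes \<phi> :: "L2 \<Rightarrow> real"
  assumes [measurable]: "\<phi> \<in> borel_measurable borel" and j: "1 \<le> j"
  shows "(LINT \<omega>|M. \<phi> (Xs j \<omega>)) = (LINT \<omega>|M. \<phi> (X \<omega>))"
    and "integrable M (\<lambda>\<omega>. \<phi> (Xs j \<omega>)) \<longleftrightarrow> integrable M (\<lambda>\<omega>. \<phi> (X \<omega>))"
proof -
  note [measurable] = Xs_measurable[OF j]
  show "(LINT \<omega>|M. \<phi> (Xs j \<omega>)) = (LINT \<omega>|M. \<phi> (X \<omega>))"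
    using arg_cong[OF Xs_distr[OF j], of "\<lambda>N. integral\<^sup>L N \<phi>"] by (simp add: integral_distr)
  show "integrable M (\<lambda>\<omega>. \<phi> (Xs j \<omega>)) \<longleftrightarrow> integrable M (\<lambda>\<omega>. \<phi> (X \<omega>))"
    using arg_cong[OF Xs_distr[OF j], of "\<lambda>N. integrable N \<phi>"] by (simp add: integrable_distr_eq)
qed

text \<open>Only diagonal terms survive in the squared sum of independent centred summands, and a
  variance is at most the raw second moment. The mean is given by an equation for \<open>m\<close>,
  so that definitions such as \<open>cas_mean_def\<close> fit directly.\<close>

lemma emean_mean_square:
  fixes \<phi> :: "L2 \<Rightarrow> real"
  assumes [measurable]: "\<phi> \<in> borel_measurable borel" and int: "integrable M (\<lambda>\<omega>. (\<phi> (X \<omega>))\<^sup>2)"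
    and n: "0 < n" and m: "m = (LINT \<omega>|M. \<phi> (X \<omega>))"
  shows "integrable M (\<lambda>\<omega>. (emean (\<lambda>j. Xs j \<omega>) n \<phi> - m)\<^sup>2)"
    and "(LINT \<omega>|M. (emean (\<lambda>j. Xs j \<omega>) n \<phi> - m)\<^sup>2) \<le> (LINT \<omega>|M. (\<phi> (X \<omega>))\<^sup>2) / n"
proof -
  define Y where "Y j \<omega> = \<phi> (Xs j \<omega>) - m" for j \<omega>
  have int1: "integrable M (\<lambda>\<omega>. \<phi> (X \<omega>))"
    by (rule M2.square_integrable_imp_integrable[OF _ int]) simp
  have int2: "integrable M (\<lambda>\<omega>. (\<phi> (X \<omega>) - m)\<^sup>2)"
    unfolding power2_diff using int int1 by auto
  have var: "(LINT \<omega>|M. (\<phi> (X \<omega>) - m)\<^sup>2) \<le> (LINT \<omega>|M. (\<phi> (X \<omega>))\<^sup>2)"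
    unfolding power2_diff using int int1 m by (simp add: M2.prob_space power2_eq_square)
  have ind: "M2.indep_vars (\<lambda>_. borel) Y {1..n}"
    unfolding Y_def[abs_def]
    by (rule M2.indep_vars_compose2[OF M2.indep_vars_subset[OF Xs_indep]]) auto
  have *: "integrable M (\<lambda>\<omega>. (\<Sum>j\<in>{1..n}. Y j \<omega>)\<^sup>2)
    \<and> (LINT \<omega>|M. (\<Sum>j\<in>{1..n}. Y j \<omega>)\<^sup>2) = (\<Sum>j\<in>{1..n}. LINT \<omega>|M. (Y j \<omega>)\<^sup>2)"
  proof (rule M2.sum_indep_square[OF _ ind])
    fix j assume j: "j \<in> {1..n}"
    show "integrable M (\<lambda>\<omega>. (Y j \<omega>)\<^sup>2)"
      unfolding Y_def using sample_integral(2)[of "\<lambda>x. (\<phi> x - m)\<^sup>2" j] int2 j by simp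
    have "(LINT \<omega>|M. \<phi> (X \<omega>) - m) = 0" using int1 m by (simp add: M2.prob_space)
    then show "(LINT \<omega>|M. Y j \<omega>) = 0"
      unfolding Y_def using sample_integral(1)[of "\<lambda>x. \<phi> x - m" j] j by simp
  qed simp
  have eq: "(emean (\<lambda>j. Xs j \<omega>) n \<phi> - m)\<^sup>2 = (1 / real n)\<^sup>2 * (\<Sum>j\<in>{1..n}. Y j \<omega>)\<^sup>2" for \<omega>
  proof -
    have "emean (\<lambda>j. Xs j \<omega>) n \<phi> - m = (1 / real n) * (\<Sum>j\<in>{1..n}. Y j \<omega>)"
      using n by (simp add: emean_def Y_def sum_subtractf field_simps)
    then show ?thesis by (simp only: power_mult_distrib)
  qed
  show "integrable M (\<lambda>\<omega>. (emean (\<lambda>j. Xs j \<omega>) n \<phi> - m)\<^sup>2)"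
    unfolding eq using * by (intro integrable_mult_right) auto
  have "(LINT \<omega>|M. (emean (\<lambda>j. Xs j \<omega>) n \<phi> - m)\<^sup>2) = (1 / real n)\<^sup>2 * (\<Sum>j\<in>{1..n}. LINT \<omega>|M. (Y j \<omega>)\<^sup>2)"
    unfolding eq integral_mult_right_zero using * by simp
  also have "(\<Sum>j\<in>{1..n}. LINT \<omega>|M. (Y j \<omega>)\<^sup>2) = (\<Sum>j\<in>{1..n}. LINT \<omega>|M. (\<phi> (X \<omega>) - m)\<^sup>2)"
    unfolding Y_def by (intro sum.cong refl sample_integral(1)) auto
  also have "(1 / real n)\<^sup>2 * \<dots> = (LINT \<omega>|M. (\<phi> (X \<omega>) - m)\<^sup>2) / n"
    using n by (simp add: power2_eq_square)
  also have "\<dots> \<le> (LINT \<omega>|M. (\<phi> (X \<omega>))\<^sup>2) / n"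
    using var by (rule divide_right_mono) simp
  finally show "(LINT \<omega>|M. (emean (\<lambda>j. Xs j \<omega>) n \<phi> - m)\<^sup>2) \<le> (LINT \<omega>|M. (\<phi> (X \<omega>))\<^sup>2) / n" .
qed

text \<open>The 8 accounts for the two \<open>cas\<close> averages, whose squared summands are at
  most 4 each.\<close>

definition moment_bound :: real
  where "moment_bound = 8 + (LINT \<omega>|M. (norm (X \<omega>))\<^sup>2) + (LINT \<omega>|M. norm (X \<omega>) ^ 4)"

text \<open>The mean square error of the average of \<open>(inner f y)\<^sup>2\<close> involves
  fourth moments and grows like \<open>norm f ^ 4\<close>; the other three terms are absorbed into
  \<open>1 + norm f ^ 4\<close>.\<close>

lemma square_error_expectation:
  assumes n: "0 < n"
  shows "integrable M (\<lambda>\<omega>. square_error (\<lambda>j. Xs j \<omega>) n f)"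
    and "(LINT \<omega>|M. square_error (\<lambda>j. Xs j \<omega>) n f) \<le> moment_bound * (1 + norm f ^ 4) / n"
proof -
  let ?m2 = "LINT \<omega>|M. (norm (X \<omega>))\<^sup>2" and ?m4 = "LINT \<omega>|M. norm (X \<omega>) ^ 4"
  have cas: "integrable M (\<lambda>\<omega>. (cas (g (X \<omega>)))\<^sup>2)" "(LINT \<omega>|M. (cas (g (X \<omega>)))\<^sup>2) \<le> 4"
    if [measurable]: "g \<in> borel_measurable borel" for g
  proof -
    have sq: "(cas t)\<^sup>2 \<le> 4" for t
      using power_mono[OF abs_cas_le abs_ge_zero, of t 2] by simp
    show int: "integrable M (\<lambda>\<omega>. (cas (g (X \<omega>)))\<^sup>2)"
      by (rule M2.integrable_const_bound[where B = 4]) (use sq in auto)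
    have "(LINT \<omega>|M. (cas (g (X \<omega>)))\<^sup>2) \<le> (LINT \<omega>|M. 4)"
      using sq by (intro integral_mono int) auto
    then show "(LINT \<omega>|M. (cas (g (X \<omega>)))\<^sup>2) \<le> 4" by (simp add: M2.prob_space)
  qed
  note 1 = emean_mean_square[OF _ cas(1)[of "inner f"] n cas_mean_def]
  note 4 = emean_mean_square[OF _ cas(1)[of "\<lambda>y. - inner f y"] n cas_refl_mean_def]
  note 2 = emean_mean_square[of "inner f", OF _ integrable_inner_square n mean_inner[symmetric]]
  note 3 = emean_mean_square[OF _ integrable_inner_fourth n second_moment_def]
  show "integrable M (\<lambda>\<omega>. square_error (\<lambda>j. Xs j \<omega>) n f)"
    unfolding square_error_def using 1(1) 2(1) 3(1) 4(1) by simp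
  have "(LINT \<omega>|M. (inner f (X \<omega>))\<^sup>2) \<le> (norm f)\<^sup>2 * ?m2"
    using second_moment_le unfolding second_moment_def .
  also have "\<dots> \<le> (1 + norm f ^ 4) * ?m2"
    by (intro mult_right_mono square_le_one_plus_fourth) simp
  finally have b2: "(LINT \<omega>|M. (inner f (X \<omega>))\<^sup>2) \<le> (1 + norm f ^ 4) * ?m2" .
  have "(LINT \<omega>|M. ((inner f (X \<omega>))\<^sup>2)\<^sup>2) \<le> (LINT \<omega>|M. norm f ^ 4 * norm (X \<omega>) ^ 4)"
    by (intro integral_mono integrable_inner_fourth inner_fourth_le integrable_mult_right X_moment)
  also have "\<dots> \<le> (1 + norm f ^ 4) * ?m4"
    unfolding integral_mult_right_zero by (intro mult_right_mono) auto
  finally have b3: "(LINT \<omega>|M. ((inner f (X \<omega>))\<^sup>2)\<^sup>2) \<le> (1 + norm f ^ 4) * ?m4" .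
  have b14: "(LINT \<omega>|M. (cas (inner f (X \<omega>)))\<^sup>2) + (LINT \<omega>|M. (cas (- inner f (X \<omega>)))\<^sup>2) \<le> (1 + norm f ^ 4) * 8"
    by (rule order_trans[OF add_mono[OF cas(2) cas(2)]]) simp_all
  have "(LINT \<omega>|M. square_error (\<lambda>j. Xs j \<omega>) n f)
      = (LINT \<omega>|M. (emean (\<lambda>j. Xs j \<omega>) n (\<lambda>y. cas (inner f y)) - cas_mean f)\<^sup>2)
        + (LINT \<omega>|M. (emean (\<lambda>j. Xs j \<omega>) n (inner f) - 0)\<^sup>2)
        + (LINT \<omega>|M. (emean (\<lambda>j. Xs j \<omega>) n (\<lambda>y. (inner f y)\<^sup>2) - second_moment f)\<^sup>2)
        + (LINT \<omega>|M. (emean (\<lambda>j. Xs j \<omega>) n (\<lambda>y. cas (- inner f y)) - cas_refl_mean f)\<^sup>2)"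
    unfolding square_error_def using 1(1) 2(1) 3(1) 4(1) by simp
  also have "\<dots> \<le> ((LINT \<omega>|M. (cas (inner f (X \<omega>)))\<^sup>2) + (LINT \<omega>|M. (inner f (X \<omega>))\<^sup>2)
      + (LINT \<omega>|M. ((inner f (X \<omega>))\<^sup>2)\<^sup>2) + (LINT \<omega>|M. (cas (- inner f (X \<omega>)))\<^sup>2)) / n"
    unfolding add_divide_distrib using 1(2) 2(2) 3(2) 4(2) by (intro add_mono) auto
  also have "\<dots> \<le> moment_bound * (1 + norm f ^ 4) / n"
    using b2 b3 b14 by (intro divide_right_mono) (auto simp: moment_bound_def algebra_simps)
  finally show "(LINT \<omega>|M. square_error (\<lambda>j. Xs j \<omega>) n f) \<le> moment_bound * (1 + norm f ^ 4) / n" .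
qed

section \<open>The score function, its mean and its variance\<close>

text \<open>\<open>weight_Q\<close> and \<open>weight_M\<close> form a majorant of \<open>xi\<close>
  with separated variables, which makes domination on the product space a matter of two single
  integrals. The 5 in \<open>weight_M\<close> is the constant term in the proof of
  \<open>abs_xi_le\<close>.\<close>

definition weight_Q :: "L2 \<Rightarrow> real" where "weight_Q f = 1 + (norm f)\<^sup>2"

definition weight_M :: "L2 \<Rightarrow> real"
  where "weight_M x = 5 * (1 + (LINT \<omega>|M. (norm (X \<omega>))\<^sup>2)) * (1 + (norm x)\<^sup>2)"

lemma weights_measurable [measurable]:
  "weight_Q \<in> borel_measurable borel" "weight_M \<in> borel_measurable borel"
  unfolding weight_Q_def[abs_def] weight_M_def[abs_def] by measurable

lemma weight_Q_nonneg: "0 \<le> weight_Q f"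
  by (simp add: weight_Q_def)

lemma weight_M_nonneg: "0 \<le> weight_M x"
  by (simp add: weight_M_def)

lemma integrable_weight_Q: "integrable Q weight_Q"
  unfolding weight_Q_def[abs_def] using Q_moment2 by simp

lemma integrable_weight_M_square: "integrable M (\<lambda>\<omega>. (weight_M (X \<omega>))\<^sup>2)"
proof -
  have "integrable M (\<lambda>\<omega>. 1 + 2 * (norm (X \<omega>))\<^sup>2 + norm (X \<omega>) ^ 4)"
    using X_moment X_moment2 by simp
  then have "integrable M (\<lambda>\<omega>. (1 + (norm (X \<omega>))\<^sup>2)\<^sup>2)"
    by (simp add: power2_eq_square power4_eq_xxxx algebra_simps)
  then show ?thesis
    unfolding weight_M_def power_mult_distrib by (rule integrable_mult_right)
qed

lemma integrable_weight_M: "integrable M (\<lambda>\<omega>. weight_M (X \<omega>))"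
  by (rule M2.square_integrable_imp_integrable[OF _ integrable_weight_M_square]) simp

lemma abs_xi_le: "\<bar>xi M X f x\<bar> \<le> weight_Q f * weight_M x"
proof -
  let ?m2 = "LINT \<omega>|M. (norm (X \<omega>))\<^sup>2"
  let ?p = "(norm f)\<^sup>2" and ?q = "(norm x)\<^sup>2"
  have m2: "0 \<le> ?m2" by simp
  have "exp (- second_moment f / 2) \<le> 1" using second_moment_nonneg[of f] by simp
  \<comment> \<open>The crude bound 2 cancels the factor 1/2 of the quadratic term.\<close>
  then have e: "exp (- second_moment f / 2) \<le> 2" by linarith
  have "\<bar>inner f x * cas_refl_mean f\<bar> \<le> \<bar>inner f x\<bar> * 2"
    unfolding abs_mult by (intro mult_left_mono abs_cas_refl_mean_le) simp
  also have "\<dots> \<le> 1 + (inner f x)\<^sup>2"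
    using sum_squares_bound[of "\<bar>inner f x\<bar>" 1] by (simp add: power2_eq_square abs_mult_self_eq)
  finally have 1: "\<bar>inner f x * cas_refl_mean f\<bar> \<le> 1 + (inner f x)\<^sup>2" .
  have "\<bar>1 / 2 * exp (- second_moment f / 2) * ((inner f x)\<^sup>2 - second_moment f)\<bar>
      \<le> 1 * \<bar>(inner f x)\<^sup>2 - second_moment f\<bar>"
    unfolding abs_mult using e by (intro mult_right_mono) auto
  also have "\<dots> \<le> (inner f x)\<^sup>2 + second_moment f"
    using second_moment_nonneg[of f] zero_le_power2[of "inner f x"] by (simp add: abs_le_iff)
  finally have 2: "\<bar>1 / 2 * exp (- second_moment f / 2) * ((inner f x)\<^sup>2 - second_moment f)\<bar>
      \<le> (inner f x)\<^sup>2 + second_moment f" .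
  have "\<bar>a - b - c + d\<bar> \<le> \<bar>a\<bar> + \<bar>b\<bar> + (\<bar>c\<bar> + \<bar>d\<bar>)" for a b c d :: real by linarith
  then have "\<bar>xi M X f x\<bar> \<le> \<bar>cas (inner f x)\<bar> + \<bar>cas_mean f\<bar> + (\<bar>inner f x * cas_refl_mean f\<bar>
      + \<bar>1 / 2 * exp (- second_moment f / 2) * ((inner f x)\<^sup>2 - second_moment f)\<bar>)"
    unfolding xi_eq .
  also have "\<dots> \<le> 2 + 2 + (1 + ?p * ?q + (?p * ?q + ?p * ?m2))"
    by (intro add_mono abs_cas_le abs_cas_mean_le order_trans[OF 1] order_trans[OF 2]
        inner_square_le second_moment_le order_refl)
  also have "\<dots> \<le> weight_Q f * weight_M x"
  proof -
    have "0 \<le> ?p * ?q" "0 \<le> ?p * ?m2" "0 \<le> ?q * ?m2" "0 \<le> ?p * (?q * ?m2)" "0 \<le> ?p" "0 \<le> ?q"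
      using m2 by (auto intro!: mult_nonneg_nonneg)
    then show ?thesis using m2 unfolding weight_Q_def weight_M_def
      by (simp add: algebra_simps)
  qed
  finally show ?thesis .
qed

text \<open>The function \<open>\<eta>\<close> of the introductory overview.\<close>

definition score :: "L2 \<Rightarrow> real" where "score x = (LINT f|Q. 2 * z_fun M X f * xi M X f x)"

lemma score_measurable [measurable]: "score \<in> borel_measurable borel"
  unfolding score_def[abs_def] by measurable

lemma abs_z_xi_le: "\<bar>2 * z_fun M X f * xi M X f x\<bar> \<le> 6 * weight_Q f * weight_M x"
proof -
  have "\<bar>2 * z_fun M X f * xi M X f x\<bar> = (2 * \<bar>z_fun M X f\<bar>) * \<bar>xi M X f x\<bar>" by (simp add: abs_mult)
  also have "\<dots> \<le> 6 * (weight_Q f * weight_M x)"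
    using abs_z_fun_le[of f] by (intro mult_mono abs_xi_le) auto
  finally show ?thesis by simp
qed

lemma integrable_z_xi: "integrable Q (\<lambda>f. 2 * z_fun M X f * xi M X f x)"
proof (rule Bochner_Integration.integrable_bound)
  show "integrable Q (\<lambda>f. 6 * weight_Q f * weight_M x)"
    using integrable_weight_Q by simp
  show "AE f in Q. norm (2 * z_fun M X f * xi M X f x) \<le> norm (6 * weight_Q f * weight_M x)"
    using order_trans[OF abs_z_xi_le abs_ge_self] by simp
qed measurable

lemma abs_score_le: "\<bar>score x\<bar> \<le> (6 * (LINT f|Q. weight_Q f)) * weight_M x"
proof -
  have "\<bar>score x\<bar> \<le> (LINT f|Q. \<bar>2 * z_fun M X f * xi M X f x\<bar>)"
    unfolding score_def by (rule integral_abs_bound)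
  also have "\<dots> \<le> (LINT f|Q. 6 * weight_Q f * weight_M x)"
    by (intro integral_mono integrable_abs integrable_z_xi abs_z_xi_le)
      (use integrable_weight_Q in simp)
  finally show ?thesis using integrable_weight_Q by simp
qed

text \<open>Fubini's theorem in the one form used for both moments of the score: \<open>h\<close> is
  1 for the mean, and \<open>xi\<close> or \<open>score\<close> itself for the second
  moment.\<close>

lemma integral_swap_score:
  assumes [measurable]: "h \<in> borel_measurable M"
    and bound: "\<And>\<omega>. \<bar>h \<omega>\<bar> \<le> b \<omega>" and int: "integrable M (\<lambda>\<omega>. weight_M (X \<omega>) * b \<omega>)"
  shows "(LINT \<omega>|M. score (X \<omega>) * h \<omega>)
    = (LINT f|Q. 2 * z_fun M X f * (LINT \<omega>|M. xi M X f (X \<omega>) * h \<omega>))"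
proof -
  define F where "F f \<omega> = 2 * z_fun M X f * xi M X f (X \<omega>) * h \<omega>" for f \<omega>
  have "integrable (Q \<Otimes>\<^sub>M M) (case_prod F)"
  proof (rule integrable_pair_dominated[OF _ _ int])
    show "case_prod F \<in> borel_measurable (Q \<Otimes>\<^sub>M M)" unfolding F_def by measurable
    show "integrable Q (\<lambda>f. 6 * weight_Q f)" using integrable_weight_Q by simp
    show "\<bar>F f \<omega>\<bar> \<le> 6 * weight_Q f * (weight_M (X \<omega>) * b \<omega>)" for f \<omega>
      using mult_mono[OF abs_z_xi_le[of f "X \<omega>"] bound[of \<omega>]] weight_Q_nonneg[of f] weight_M_nonneg[of "X \<omega>"]
      by (simp add: F_def abs_mult mult.assoc)
  qed
  from Fubini_integral[OF this] have "(LINT \<omega>|M. LINT f|Q. F f \<omega>) = (LINT f|Q. LINT \<omega>|M. F f \<omega>)" .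
  moreover have "(LINT f|Q. F f \<omega>) = score (X \<omega>) * h \<omega>" for \<omega>
    unfolding F_def score_def by (rule integral_mult_left_zero)
  moreover have "(LINT \<omega>|M. F f \<omega>) = 2 * z_fun M X f * (LINT \<omega>|M. xi M X f (X \<omega>) * h \<omega>)" for f
    unfolding F_def mult.assoc by simp
  ultimately show ?thesis by simp
qed

lemma score_mean: "(LINT \<omega>|M. score (X \<omega>)) = 0"
proof -
  have "(LINT \<omega>|M. xi M X f (X \<omega>)) = 0" for f
  proof -
    have "integrable M (\<lambda>\<omega>. cas (inner f (X \<omega>)))" by (rule integrable_cas) simp
    then show ?thesis unfolding xi_eq
      using integrable_inner[of f] integrable_inner_square[of f]
      by (simp add: M2.prob_space mean_inner second_moment_def[symmetric] cas_mean_def[symmetric])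
  qed
  then show ?thesis
    using integral_swap_score[of "\<lambda>_. 1" "\<lambda>_. 1"] integrable_weight_M by simp
qed

lemma score_second_moment:
  shows "integrable M (\<lambda>\<omega>. (score (X \<omega>))\<^sup>2)"
    and "(LINT \<omega>|M. (score (X \<omega>))\<^sup>2)
      = 4 * (LINT f|Q. (LINT g|Q. K_star M X f g * z_fun M X f * z_fun M X g))"
proof -
  let ?c = "6 * (LINT f|Q. weight_Q f)"
  have int: "integrable M (\<lambda>\<omega>. weight_M (X \<omega>) * (c * weight_M (X \<omega>)))" for c
    using integrable_mult_right[OF integrable_weight_M_square, of c] by (simp add: power2_eq_square ac_simps)
  show "integrable M (\<lambda>\<omega>. (score (X \<omega>))\<^sup>2)"
  proof (rule Bochner_Integration.integrable_bound)
    show "integrable M (\<lambda>\<omega>. ?c\<^sup>2 * (weight_M (X \<omega>))\<^sup>2)"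
      by (rule integrable_mult_right[OF integrable_weight_M_square])
    have "(score x)\<^sup>2 \<le> ?c\<^sup>2 * (weight_M x)\<^sup>2" for x
      using power_mono[OF abs_score_le abs_ge_zero, of x 2] by (simp add: power_mult_distrib)
    then show "AE \<omega> in M. norm ((score (X \<omega>))\<^sup>2) \<le> norm (?c\<^sup>2 * (weight_M (X \<omega>))\<^sup>2)" by simp
  qed simp
  \<comment> \<open>One score factor is expanded for fixed \<open>f\<close>, then the other one;
    each brings a factor 2, hence the 4.\<close>
  have inner: "(LINT \<omega>|M. xi M X f (X \<omega>) * score (X \<omega>)) = (LINT g|Q. 2 * z_fun M X g * K_star M X f g)" for f
  proof -
    have "(LINT \<omega>|M. score (X \<omega>) * xi M X f (X \<omega>))
        = (LINT g|Q. 2 * z_fun M X g * (LINT \<omega>|M. xi M X g (X \<omega>) * xi M X f (X \<omega>)))"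
      by (rule integral_swap_score[OF _ abs_xi_le int]) simp
    then show ?thesis by (simp add: K_star_def mult.commute)
  qed
  have "(LINT \<omega>|M. score (X \<omega>) * score (X \<omega>))
      = (LINT f|Q. 2 * z_fun M X f * (LINT \<omega>|M. xi M X f (X \<omega>) * score (X \<omega>)))"
    by (rule integral_swap_score[OF _ abs_score_le int]) simp
  also have "\<dots> = (LINT f|Q. 4 * (LINT g|Q. K_star M X f g * z_fun M X f * z_fun M X g))"
    unfolding inner integral_mult_right_zero[symmetric]
    by (intro Bochner_Integration.integral_cong refl) (simp add: ac_simps)
  finally show "(LINT \<omega>|M. (score (X \<omega>))\<^sup>2)
      = 4 * (LINT f|Q. (LINT g|Q. K_star M X f g * z_fun M X f * z_fun M X g))"
    by (simp add: power2_eq_square)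
qed

section \<open>Linearization after integration over the weight\<close>

lemma T_stat_linearization:
  assumes n: "0 < n" and int: "integrable Q (square_error x n)"
  shows "\<bar>T_stat Q x n - tau Q M X - emean x n score\<bar> \<le> 45 * (LINT f|Q. square_error x n f)"
proof -
  have dev_meas [measurable]: "dev x n \<in> borel_measurable borel"
    unfolding dev_def[abs_def] emean_def by measurable
  let ?z = "z_fun M X"
  have d2: "integrable Q (\<lambda>f. (dev x n f)\<^sup>2)" and z2: "integrable Q (\<lambda>f. (?z f)\<^sup>2)"
  proof -
    have "\<bar>(u::real)\<^sup>2\<bar> \<le> 3\<^sup>2" if "\<bar>u\<bar> \<le> 3" for u using power_mono[OF that, of 2] by simp
    then show "integrable Q (\<lambda>f. (dev x n f)\<^sup>2)" "integrable Q (\<lambda>f. (?z f)\<^sup>2)"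
      using abs_dev_le abs_z_fun_le by (auto intro!: integrable_Q_bounded[where c = "3\<^sup>2"])
  qed
  have emean: "emean x n score = (LINT f|Q. emean x n (\<lambda>y. 2 * ?z f * xi M X f y))"
    "integrable Q (\<lambda>f. emean x n (\<lambda>y. 2 * ?z f * xi M X f y))"
    unfolding emean_def score_def
    by (subst integral_mult_right_zero, subst Bochner_Integration.integral_sum)
      (auto intro!: integrable_mult_right Bochner_Integration.integrable_sum integrable_z_xi)
  let ?r = "\<lambda>f. (dev x n f)\<^sup>2 - (?z f)\<^sup>2 - emean x n (\<lambda>y. 2 * ?z f * xi M X f y)"
  have "T_stat Q x n - tau Q M X - emean x n score = (LINT f|Q. ?r f)"
    unfolding T_stat_eq tau_eq emean(1) using d2 z2 emean(2) by simp
  also have "\<bar>\<dots>\<bar> \<le> (LINT f|Q. \<bar>?r f\<bar>)" by (rule integral_abs_bound)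
  also have "\<dots> \<le> (LINT f|Q. 45 * square_error x n f)"
  proof (rule integral_mono)
    fix f
    \<comment> \<open>A difference of squares is the squared increment plus \<open>2 * ?z f\<close>
      times the increment. The zeroth-order bound gives 27, and
      \<open>\<bar>?z f\<bar> \<le> 3\<close> with the first-order bound gives 6 times 3, in total
      45.\<close>
    have "?r f = (dev x n f - ?z f)\<^sup>2 + 2 * ?z f * (dev x n f - ?z f - emean x n (xi M X f))"
      unfolding emean_cmult by (simp add: power2_eq_square algebra_simps)
    also have "\<bar>\<dots>\<bar> \<le> \<bar>(dev x n f - ?z f)\<^sup>2\<bar> + \<bar>2 * ?z f * (dev x n f - ?z f - emean x n (xi M X f))\<bar>"
      by (rule abs_triangle_ineq)
    also have "\<dots> \<le> 27 * square_error x n f + 6 * (3 * square_error x n f)"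
    proof (rule add_mono)
      show "\<bar>(dev x n f - ?z f)\<^sup>2\<bar> \<le> 27 * square_error x n f" using dev_zeroth_order[OF n] by simp
      show "\<bar>2 * ?z f * (dev x n f - ?z f - emean x n (xi M X f))\<bar> \<le> 6 * (3 * square_error x n f)"
        unfolding abs_mult using abs_z_fun_le[of f] by (intro mult_mono dev_first_order[OF n]) auto
    qed
    finally show "\<bar>?r f\<bar> \<le> 45 * square_error x n f" by simp
  qed (use int d2 z2 emean(2) in auto)
  finally show ?thesis by simp
qed

section \<open>Joint measurability in the weight variable and the sample\<close>

text \<open>Only the entries from 1 on enter, and these are measurable. The averaged function may
  depend on the point \<open>w\<close>, which covers nested averages such as centring at the sample
  mean.\<close>

lemma emean_sample_measurable:
  assumes W [measurable]: "W \<in> measurable N M"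
    and \<phi> [measurable]: "(\<lambda>(w, y). \<phi> w y) \<in> borel_measurable (N \<Otimes>\<^sub>M borel)"
  shows "(\<lambda>w. emean (\<lambda>j. Xs j (W w)) n (\<phi> w)) \<in> borel_measurable N"
  unfolding emean_def
proof (intro borel_measurable_times borel_measurable_const borel_measurable_sum)
  fix j assume "j \<in> {1..n}"
  then have [measurable]: "Xs j \<in> borel_measurable M" by (intro Xs_measurable) simp
  have "(\<lambda>w. (w, Xs j (W w))) \<in> measurable N (N \<Otimes>\<^sub>M borel)" by measurable
  from measurable_compose[OF this \<phi>] show "(\<lambda>w. \<phi> w (Xs j (W w))) \<in> borel_measurable N" by simp
qed

lemma sample_mean_inner_measurable [measurable]:
  "(\<lambda>p. emean (\<lambda>j. Xs j (snd p)) n (inner (fst p))) \<in> borel_measurable (Q \<Otimes>\<^sub>M M)"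
  by (rule emean_sample_measurable) measurable

lemma dev_sample_measurable:
  assumes "0 < n"
  shows "(\<lambda>(f, \<omega>). dev (\<lambda>j. Xs j \<omega>) n f) \<in> borel_measurable (Q \<Otimes>\<^sub>M M)"
proof -
  let ?N = "Q \<Otimes>\<^sub>M M"
  have [measurable]:
    "(\<lambda>p. emean (\<lambda>j. Xs j (snd p)) n (\<lambda>y. cas (inner (fst p) y - emean (\<lambda>j. Xs j (snd p)) n (inner (fst p)))))
      \<in> borel_measurable ?N"
    by (rule emean_sample_measurable) measurable
  have [measurable]: "(\<lambda>p. emean (\<lambda>j. Xs j (snd p)) n (\<lambda>y. (inner (fst p) y)\<^sup>2)) \<in> borel_measurable ?N"
    by (rule emean_sample_measurable) measurable
  show ?thesis unfolding dev_alt[OF assms] case_prod_beta by measurable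
qed

lemma square_error_sample_measurable:
  "(\<lambda>(f, \<omega>). square_error (\<lambda>j. Xs j \<omega>) n f) \<in> borel_measurable (Q \<Otimes>\<^sub>M M)"
proof -
  let ?N = "Q \<Otimes>\<^sub>M M"
  have [measurable]: "(\<lambda>p. emean (\<lambda>j. Xs j (snd p)) n (\<lambda>y. cas (inner (fst p) y))) \<in> borel_measurable ?N"
    by (rule emean_sample_measurable) measurable
  have [measurable]: "(\<lambda>p. emean (\<lambda>j. Xs j (snd p)) n (\<lambda>y. cas (- inner (fst p) y))) \<in> borel_measurable ?N"
    by (rule emean_sample_measurable) measurable
  have [measurable]: "(\<lambda>p. emean (\<lambda>j. Xs j (snd p)) n (\<lambda>y. (inner (fst p) y)\<^sup>2)) \<in> borel_measurable ?N"
    by (rule emean_sample_measurable) measurable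
  show ?thesis unfolding square_error_def case_prod_beta by measurable
qed

lemma T_stat_measurable:
  assumes "0 < n"
  shows "(\<lambda>\<omega>. T_stat Q (\<lambda>j. Xs j \<omega>) n) \<in> borel_measurable M"
proof -
  note [measurable] = dev_sample_measurable[OF assms]
  show ?thesis unfolding T_stat_eq by measurable
qed

section \<open>Error in mean and passage to the limit\<close>

definition Q_bound :: real where "Q_bound = moment_bound * (LINT f|Q. 1 + norm f ^ 4)"

lemma square_error_double_integral:
  assumes n: "0 < n"
  shows "AE \<omega> in M. integrable Q (square_error (\<lambda>j. Xs j \<omega>) n)"
    and "integrable M (\<lambda>\<omega>. LINT f|Q. square_error (\<lambda>j. Xs j \<omega>) n f)"
    and "(LINT \<omega>|M. LINT f|Q. square_error (\<lambda>j. Xs j \<omega>) n f) \<le> Q_bound / n"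
proof -
  define F where "F f \<omega> = square_error (\<lambda>j. Xs j \<omega>) n f" for f \<omega>
  have meas [measurable]: "case_prod F \<in> borel_measurable (Q \<Otimes>\<^sub>M M)"
    unfolding F_def using square_error_sample_measurable by simp
  have F: "integrable M (F f)" "(LINT \<omega>|M. F f \<omega>) \<le> moment_bound * (1 + norm f ^ 4) / n" "0 \<le> F f \<omega>" for f \<omega>
    unfolding F_def[abs_def] by (rule square_error_expectation[OF n] square_error_nonneg)+
  have dom: "integrable Q (\<lambda>f. moment_bound * (1 + norm f ^ 4) / n)"
    using Q_moment by simp
  have int1: "integrable Q (\<lambda>f. LINT \<omega>|M. F f \<omega>)"
  proof (rule Bochner_Integration.integrable_bound[OF dom])
    have "norm (LINT \<omega>|M. F f \<omega>) \<le> norm (moment_bound * (1 + norm f ^ 4) / n)" for f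
    proof -
      have "0 \<le> (LINT \<omega>|M. F f \<omega>)" by (simp add: F(3))
      then show ?thesis
        using order_trans[OF F(2) abs_ge_self, of f] by (simp only: real_norm_def abs_of_nonneg)
    qed
    then show "AE f in Q. norm (LINT \<omega>|M. F f \<omega>) \<le> norm (moment_bound * (1 + norm f ^ 4) / n)"
      by (rule AE_I2)
  qed measurable
  \<comment> \<open>As \<open>F\<close> is nonnegative, integrability of its iterated integral
    already gives joint integrability, after which the order of integration can be reversed.\<close>
  have int: "integrable (Q \<Otimes>\<^sub>M M) (case_prod F)"
    using F int1 by (intro Fubini_integrable) auto
  show "AE \<omega> in M. integrable Q (square_error (\<lambda>j. Xs j \<omega>) n)"
    using AE_integrable_snd[OF int] by (simp add: F_def)
  show "integrable M (\<lambda>\<omega>. LINT f|Q. square_error (\<lambda>j. Xs j \<omega>) n f)"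
    using integrable_snd[OF int] by (simp add: F_def)
  have "(LINT \<omega>|M. LINT f|Q. F f \<omega>) = (LINT f|Q. LINT \<omega>|M. F f \<omega>)"
    by (rule Fubini_integral[OF int])
  also have "\<dots> \<le> (LINT f|Q. moment_bound * (1 + norm f ^ 4) / n)"
    by (rule integral_mono[OF int1 dom F(2)])
  also have "\<dots> = Q_bound / n" unfolding Q_bound_def by simp
  finally show "(LINT \<omega>|M. LINT f|Q. square_error (\<lambda>j. Xs j \<omega>) n f) \<le> Q_bound / n"
    by (simp add: F_def)
qed

text \<open>The linearization error is \<open>sqrt n\<close> times 45 times an integrated square
  error whose mean is of order 1/n, which leaves the order \<open>1 / sqrt n\<close>.\<close>

lemma char_T_stat_approx:
  assumes n: "0 < n"
  shows "cmod (char (distr M borel (\<lambda>\<omega>. sqrt n * (T_stat Q (\<lambda>j. Xs j \<omega>) n - tau Q M X))) t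
      - char (distr M borel (\<lambda>\<omega>. (\<Sum>j=1..n. score (Xs j \<omega>)) / sqrt n)) t)
    \<le> \<bar>t\<bar> * (45 * Q_bound / sqrt n)"
proof -
  define S where "S \<omega> = sqrt n * (T_stat Q (\<lambda>j. Xs j \<omega>) n - tau Q M X)" for \<omega>
  define V where "V \<omega> = (\<Sum>j=1..n. score (Xs j \<omega>)) / sqrt n" for \<omega>
  define E where "E \<omega> = (LINT f|Q. square_error (\<lambda>j. Xs j \<omega>) n f)" for \<omega>
  note E = square_error_double_integral[OF n, folded E_def]
  note [measurable] = T_stat_measurable[OF n]
  have [measurable]: "S \<in> borel_measurable M" unfolding S_def[abs_def] by measurable
  have [measurable]: "V \<in> borel_measurable M"
    unfolding V_def[abs_def]
    by (intro borel_measurable_divide borel_measurable_sum measurable_compose[OF Xs_measurable score_measurable]) auto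
  have V: "V \<omega> = sqrt n * emean (\<lambda>j. Xs j \<omega>) n score" for \<omega>
    using n real_sqrt_mult_self[of n] by (simp add: V_def emean_def field_simps)
  \<comment> \<open>Almost surely only, since Fubini's theorem makes the square error integrable
    over \<open>Q\<close> for almost every sample.\<close>
  have bound: "AE \<omega> in M. \<bar>S \<omega> - V \<omega>\<bar> \<le> 45 * sqrt n * E \<omega>"
    using E(1)
  proof eventually_elim
    case (elim \<omega>)
    have "S \<omega> - V \<omega> = sqrt n * (T_stat Q (\<lambda>j. Xs j \<omega>) n - tau Q M X - emean (\<lambda>j. Xs j \<omega>) n score)"
      by (simp add: S_def V algebra_simps)
    then have "\<bar>S \<omega> - V \<omega>\<bar> = sqrt n * \<bar>T_stat Q (\<lambda>j. Xs j \<omega>) n - tau Q M X - emean (\<lambda>j. Xs j \<omega>) n score\<bar>"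
      by (simp add: abs_mult)
    also have "\<dots> \<le> sqrt n * (45 * E \<omega>)"
      unfolding E_def by (intro mult_left_mono T_stat_linearization[OF n elim]) simp
    finally show ?case by simp
  qed
  have int: "integrable M (\<lambda>\<omega>. S \<omega> - V \<omega>)"
  proof (rule Bochner_Integration.integrable_bound)
    show "integrable M (\<lambda>\<omega>. 45 * sqrt n * E \<omega>)" using E(2) by simp
    show "AE \<omega> in M. norm (S \<omega> - V \<omega>) \<le> norm (45 * sqrt n * E \<omega>)"
      using bound by eventually_elim (metis abs_ge_self order_trans real_norm_def)
  qed measurable
  have "(LINT \<omega>|M. \<bar>S \<omega> - V \<omega>\<bar>) \<le> (LINT \<omega>|M. 45 * sqrt n * E \<omega>)"
    using E(2) by (intro integral_mono_AE integrable_abs int bound) simp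
  also have "\<dots> = 45 * sqrt n * (LINT \<omega>|M. E \<omega>)" by simp
  also have "\<dots> \<le> 45 * sqrt n * (Q_bound / n)"
    by (intro mult_left_mono E(3)) simp
  also have "\<dots> = 45 * Q_bound / sqrt n"
    using n real_sqrt_mult_self[of n] by (simp add: field_simps)
  finally have "(LINT \<omega>|M. \<bar>S \<omega> - V \<omega>\<bar>) \<le> 45 * Q_bound / sqrt n" .
  then have "\<bar>t\<bar> * (LINT \<omega>|M. \<bar>S \<omega> - V \<omega>\<bar>) \<le> \<bar>t\<bar> * (45 * Q_bound / sqrt n)"
    by (rule mult_left_mono) simp
  with M2.char_distr_diff_le[OF _ _ int, of t]
  have "cmod (char (distr M borel S) t - char (distr M borel V) t) \<le> \<bar>t\<bar> * (45 * Q_bound / sqrt n)"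
    by simp
  then show ?thesis unfolding S_def[abs_def] V_def[abs_def] .
qed

text \<open>The sequence in the limit theorem starts at index 0, where the averages are empty and
  the statistic is constant in \<open>\<omega>\<close>.\<close>

lemma T_stat_zero_measurable:
  "(\<lambda>\<omega>. T_stat Q (\<lambda>j. Xs j \<omega>) 0) \<in> borel_measurable M"
  unfolding T_stat_eq dev_def emean_def by simp

lemma T_stat_weak_conv:
  "weak_conv_m (\<lambda>n. distr M borel (\<lambda>\<omega>. sqrt n * (T_stat Q (\<lambda>j. Xs j \<omega>) n - tau Q M X)))
    (centred_normal (4 * (LINT f|Q. (LINT g|Q. K_star M X f g * z_fun M X f * z_fun M X g))))"
proof (rule levy_continuity)
  let ?v = "4 * (LINT f|Q. (LINT g|Q. K_star M X f g * z_fun M X f * z_fun M X g))"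
  \<comment> \<open>The double integral is nonnegative because it is the second moment of the
    score.\<close>
  have v: "0 \<le> ?v" unfolding score_second_moment(2)[symmetric] by simp
  then show "real_distribution (centred_normal ?v)" by (rule real_distribution_centred_normal)
  have [measurable]: "(\<lambda>\<omega>. T_stat Q (\<lambda>j. Xs j \<omega>) n) \<in> borel_measurable M" for n
    using T_stat_measurable T_stat_zero_measurable by (cases "n = 0") auto
  show "real_distribution (distr M borel (\<lambda>\<omega>. sqrt n * (T_stat Q (\<lambda>j. Xs j \<omega>) n - tau Q M X)))" for n
    by (rule M2.real_distribution_distr) measurable
  fix t
  let ?S = "\<lambda>n. char (distr M borel (\<lambda>\<omega>. sqrt n * (T_stat Q (\<lambda>j. Xs j \<omega>) n - tau Q M X))) t"
  let ?V = "\<lambda>n. char (distr M borel (\<lambda>\<omega>. (\<Sum>j=1..n. score (Xs j \<omega>)) / sqrt n)) t"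
  have "?V \<longlonglongrightarrow> char (centred_normal ?v) t"
    unfolding score_second_moment(2)[symmetric]
  proof (rule M2.iid_clt_char)
    show "M2.indep_vars (\<lambda>_. borel) (\<lambda>j \<omega>. score (Xs j \<omega>)) {1..}"
      by (rule M2.indep_vars_compose2[OF Xs_indep]) simp
    show "distr M borel (\<lambda>\<omega>. score (Xs j \<omega>)) = distr M borel (\<lambda>\<omega>. score (X \<omega>))" if "1 \<le> j" for j
      using distr_distr[OF score_measurable Xs_measurable[OF that]] distr_distr[OF score_measurable X_measurable]
      by (simp add: Xs_distr[OF that] comp_def)
    show "integrable M (\<lambda>\<omega>. (score (X \<omega>))\<^sup>2)" "(LINT \<omega>|M. score (X \<omega>)) = 0"
      by (rule score_second_moment score_mean)+
  qed measurable
  moreover have "(\<lambda>n. ?S n - ?V n) \<longlonglongrightarrow> 0"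
  proof (rule Lim_null_comparison)
    show "\<forall>\<^sub>F n in sequentially. cmod (?S n - ?V n) \<le> \<bar>t\<bar> * (45 * Q_bound / sqrt n)"
      using eventually_gt_at_top[of 0] by eventually_elim (rule char_T_stat_approx)
    show "(\<lambda>n. \<bar>t\<bar> * (45 * Q_bound / sqrt (real n))) \<longlonglongrightarrow> 0"
      by (rule tendsto_mult_right_zero tendsto_divide_0[OF tendsto_const]
          filterlim_compose[OF filterlim_at_top_imp_at_infinity[OF sqrt_at_top]] filterlim_real_sequentially)+
  qed
  ultimately have "(\<lambda>n. ?V n + (?S n - ?V n)) \<longlonglongrightarrow> char (centred_normal ?v) t + 0"
    by (rule tendsto_add)
  then show "?S \<longlonglongrightarrow> char (centred_normal ?v) t" by simp
qed

end

theorem corollary6p3: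
  fixes Q :: "L2 measure" and M :: "'w measure"
    and X :: "'w \<Rightarrow> L2" and Xs :: "nat \<Rightarrow> 'w \<Rightarrow> L2"
  assumes "prob_space Q" and "sets Q = sets borel"
    and Q_symmetric: "distr Q borel uminus = Q"
    and Q_moment: "integrable Q (\<lambda>f. norm f ^ 4)"
    and "prob_space M"
    and "X \<in> borel_measurable M"
    and X_moment: "integrable M (\<lambda>\<omega>. norm (X \<omega>) ^ 4)"
    and X_centred: "(LINT \<omega>|M. X \<omega>) = 0"
    and Xs_indep: "prob_space.indep_vars M (\<lambda>_. borel) Xs {1..}"
    and Xs_distr: "\<And>j. j \<ge> 1 \<Longrightarrow> distr M borel (Xs j) = distr M borel X"
  shows "weak_conv_m
    (\<lambda>n. distr M borel (\<lambda>\<omega>. sqrt (real n) * (T_stat Q (\<lambda>j. Xs j \<omega>) n - tau Q M X)))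
    (centred_normal
      (4 * (LINT f|Q. (LINT g|Q. K_star M X f g * z_fun M X f * z_fun M X g))))"
proof -
  interpret Q: prob_space Q by fact
  interpret M: prob_space M by fact
  interpret weighted_sample Q M X Xs by unfold_locales fact+
  show ?thesis by (rule T_stat_weak_conv)
qed

end
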